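(* For $n\ge 0$, $d\ge 1$ and $k\ge 2$, let $P$ be a rooted convex polygon with $n(k-1)+d+1$ uncolored vertices. Then $$ C_{n,k,d}=\frac{d}{(k-1)n+d}\binom{kn+d-1}{n} $$ equals the number of $(k+1,d+1)$-partitions of $P$ (into $n$ regions which are $(k+1)$-gons, together with, when $d\ge 2$, the $(d+1)$-gon containing the root edge).
   Context: A rooted polygon is a convex polygon with a distinguished edge (the root edge, taken to be the top edge). A partition of a convex polygon $P$ is the plane graph obtained by drawing some chords between vertices of $P$ so that no two chords cross in the interior of $P$. For $d'\geq 3$, a $(k',d')$-partition of $P$ is a partition in which every bounded region is a $k'$-gon, except for the region containing the root edge, which is a $d'$-gon. By convention, if $d'=2$ then (the root edge being regarded as the only $2$-gon containing itself) a $(k',2)$-partition is just an ordinary $k'$-partition, i.e. a partition in which all bounded regions are $k'$-gons. A polygon with $2$ vertices is a single edge, which is considered to be a partition of itself into $0$ regions. The $(k,d)$-Catalan number is defined by $C_{n,k,d}=\frac{d}{(k-1)n+d}\binom{kn+d-1}{n}$. *)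

theory Defs
  imports "HOL-Analysis.Analysis"
begin

text \<open>The vertices of a convex polygon are its extreme points, so every vertex is a genuine corner
  and no three of them are collinear. For \<open>m \<ge> 3\<close> the polygon is automatically two-dimensional.
  A polygon with 2 vertices is a segment; it is then its own unique edge in the sense of
  \<^const>\<open>edge_of\<close>, and has no interior.\<close>

definition vertices :: "(real^2) set \<Rightarrow> (real^2) set" where
  "vertices P = {x. x extreme_point_of P}"

definition convex_polygon :: "nat \<Rightarrow> (real^2) set \<Rightarrow> bool" where
  "convex_polygon m P \<longleftrightarrow> polytope P \<and> card (vertices P) = m"

text \<open>Chords are diagonals: the sides of the polygon are always part of the plane graph, and are
  excluded here so that a partition is determined by its set of chords.\<close>

definition chords :: "(real^2) set \<Rightarrow> (real^2) set set" where
  "chords P = {closed_segment a b | a b.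
     a \<in> vertices P \<and> b \<in> vertices P \<and> a \<noteq> b \<and> \<not> closed_segment a b edge_of P}"

definition polygon_partition :: "(real^2) set \<Rightarrow> (real^2) set set \<Rightarrow> bool" where
  "polygon_partition P D \<longleftrightarrow>
     D \<subseteq> chords P \<and> (\<forall>c\<in>D. \<forall>c'\<in>D. c \<noteq> c' \<longrightarrow> c \<inter> c' \<inter> interior P = {})"

definition bounded_regions :: "(real^2) set \<Rightarrow> (real^2) set set \<Rightarrow> (real^2) set set" where
  "bounded_regions P D =
     {R \<in> components (- \<Union>({e. e edge_of P} \<union> D)). bounded R}"

text \<open>Regions are open, hence the closures: a region is a \<open>k'\<close>-gon if its closure is one, and it
  contains the root edge \<open>r\<close> if its closure does. For \<open>d' = 2\<close> the root edge itself plays the role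
  of the \<open>d'\<close>-gon, and all regions have to be \<open>k'\<close>-gons. The definition is meaningful for
  \<open>d' \<ge> 2\<close> only.\<close>

definition kd_partition ::
  "nat \<Rightarrow> nat \<Rightarrow> (real^2) set \<Rightarrow> (real^2) set \<Rightarrow> (real^2) set set \<Rightarrow> bool" where
  "kd_partition k' d' P r D \<longleftrightarrow>
     polygon_partition P D \<and>
     (if d' = 2 then \<forall>R\<in>bounded_regions P D. convex_polygon k' (closure R)
      else \<forall>R\<in>bounded_regions P D.
             convex_polygon (if r \<subseteq> closure R then d' else k') (closure R))"

definition kd_catalan :: "nat \<Rightarrow> nat \<Rightarrow> nat \<Rightarrow> real" where
  "kd_catalan n k d =
     real d / ((real k - 1) * real n + real d) * real ((k * n + d - 1) choose n)"

end

theory Submission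
  imports Defs
begin

text \<open>Write \<open>A(n, d)\<close> for the number of \<open>(k+1, d+1)\<close>-partitions of a rooted polygon with \<open>n(k-1) + d + 1\<close>
vertices. These numbers satisfy \<open>A(0, d) = 1\<close>, \<open>A(n, 1) = A(n-1, k)\<close> for \<open>n \<ge> 1\<close>, and
\<open>A(n, d) = A(n, d-1) + A(n-1, d+k-1)\<close> for \<open>n \<ge> 1\<close>, \<open>d \<ge> 2\<close>, and so do the
\<open>(k,d)\<close>-Catalan numbers (\<open>kd_catalan_0\<close>, \<open>kd_catalan_1\<close>, \<open>kd_catalan_rec\<close>); this is the generating
function identity \<open>B\<^sup>d = B\<^bsup>d-1\<^esup> + z B\<^bsup>d+k-1\<^esup>\<close>, a multiple of \<open>B = 1 + z B\<^sup>k\<close>, where \<open>B = \<Sum> A(n, 1) z\<^sup>n\<close>.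

The first two equations are immediate: for \<open>d = 1\<close> the region at the root edge is just one more
\<open>(k+1)\<close>-gon. For the third let \<open>a b\<close> be the root edge and \<open>v\<close> the other neighbour of \<open>a\<close>. If \<open>v\<close> is a
vertex of the region at the root edge, no chord ends at \<open>a\<close>; cutting off the triangle \<open>a b v\<close> removes
\<open>a\<close> from this region and from the polygon, and \<open>v b\<close> becomes the root edge. This gives \<open>A(n, d-1)\<close>
(\<open>ear_case_2\<close>, \<open>ear_case_ge3\<close>). Otherwise the side of the root region that leaves \<open>a\<close> towards the interior
is a chord, with a \<open>(k+1)\<close>-gon behind it. Deleting the chord merges both into a \<open>(d+k)\<close>-gon, and the chord
can be recovered, because it starts at \<open>a\<close> and cuts off exactly \<open>k + 1\<close> vertices of the merged region.
This gives \<open>A(n-1, d+k-1)\<close> (\<open>fan_case\<close>).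

All of this needs a description of the regions, which are given as connected components of an open set.
The key fact is that every region is the interior of the convex hull of a subset of the vertices, here
called a cell, and that adding one chord to a dissection splits exactly one cell, by the sides of the
line through the chord (\<open>cells_insert\<close>). Every property of regions that is needed then follows by induction
on the chords (\<open>dissection_induct\<close>): the sizes of the cells satisfy \<open>\<Sum>(|T| - 2) = |V| - 2\<close>, which
determines the number of regions; exactly one cell contains a given side of the polygon; and the sides
of cells are chords or sides of the polygon. Angles are replaced throughout by the sign of the
determinant \<open>orient\<close>.\<close>

section \<open>Orientation and points in convex position\<close>

text \<open>Twice the signed area of the triangle \<open>p q x\<close>: positive if \<open>x\<close> lies to the left of the line from
\<open>p\<close> to \<open>q\<close>. As a function of \<open>x\<close> it is affine, so that its half-planes are convex.\<close>
definition orient :: "real^2 \<Rightarrow> real^2 \<Rightarrow> real^2 \<Rightarrow> real" where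
  "orient p q x = (q$1 - p$1) * (x$2 - p$2) - (q$2 - p$2) * (x$1 - p$1)"

lemma orient_affine:
  assumes "u + v = 1"
  shows "orient p q (u *\<^sub>R x + v *\<^sub>R y) = u * orient p q x + v * orient p q y"
proof -
  have u: "u = 1 - v" using assms by simp
  show ?thesis unfolding u orient_def by (simp add: algebra_simps)
qed

lemma orient_swap: "orient q p x = - orient p q x"
  unfolding orient_def by (simp add: algebra_simps)

lemma orient_rotate: "orient p q x = orient q x p"
  unfolding orient_def by (simp add: algebra_simps)

lemma orient_end [simp]: "orient p q p = 0" "orient p q q = 0" "orient p p q = 0"
  unfolding orient_def by auto

lemma orient_inner:
  obtains n :: "real^2" where "\<And>x. orient p q x = n \<bullet> x - n \<bullet> p" and "p \<noteq> q \<Longrightarrow> n \<noteq> 0"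
proof
  let ?n = "(vector [-(q$2 - p$2), q$1 - p$1]) :: real^2"
  show "orient p q x = ?n \<bullet> x - ?n \<bullet> p" for x
    by (simp add: orient_def inner_vec_def sum_2 algebra_simps)
  show "?n \<noteq> 0" if "p \<noteq> q"
  proof
    assume "?n = 0"
    then have "?n $ 1 = 0" "?n $ 2 = 0" by simp_all
    then have "p $ 1 = q $ 1" "p $ 2 = q $ 2" by simp_all
    then show False using that by (simp add: vec_eq_iff forall_2)
  qed
qed

lemma convex_orient: "convex {x. orient p q x \<ge> 0}" "convex {x. orient p q x \<le> 0}"
    "convex {x. orient p q x > 0}" "convex {x. orient p q x = 0}"
proof -
  obtain n where n: "\<And>x. orient p q x = n \<bullet> x - n \<bullet> p" by (rule orient_inner[of p q]) blast
  show "convex {x. orient p q x \<ge> 0}" "convex {x. orient p q x \<le> 0}"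
    "convex {x. orient p q x > 0}" "convex {x. orient p q x = 0}"
    using convex_halfspace_ge[where a=n and b="n \<bullet> p"] convex_halfspace_le[where a=n and b="n \<bullet> p"]
      convex_halfspace_gt[where a=n and b="n \<bullet> p"] convex_hyperplane[where a=n and b="n \<bullet> p"]
    by (auto simp: n elim!: back_subst[where P = convex])
qed

lemma open_orient: "open {x. orient p q x > 0}"
proof -
  obtain n where n: "\<And>x. orient p q x = n \<bullet> x - n \<bullet> p" by (rule orient_inner[of p q]) blast
  show ?thesis using open_halfspace_gt[where a=n and b="n \<bullet> p"] by (simp add: n)
qed

lemma interior_orient:
  assumes "p \<noteq> q" shows "interior {x. orient p q x \<ge> 0} = {x. orient p q x > 0}"
proof -
  obtain n where n: "\<And>x. orient p q x = n \<bullet> x - n \<bullet> p" "n \<noteq> 0"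
    using orient_inner[of p q] assms by metis
  show ?thesis using interior_halfspace_ge[of n "n \<bullet> p"] n by simp
qed

lemma orient_zero_line:
  assumes "orient p q x = 0" "p \<noteq> q"
  obtains t where "x = (1 - t) *\<^sub>R p + t *\<^sub>R q"
proof -
  have e: "(q$1 - p$1) * (x$2 - p$2) = (q$2 - p$2) * (x$1 - p$1)"
    using assms(1) unfolding orient_def by simp
  obtain t where t: "x$1 - p$1 = t * (q$1 - p$1)" "x$2 - p$2 = t * (q$2 - p$2)"
  proof (cases "q$1 = p$1")
    case True
    then have ne: "q$2 - p$2 \<noteq> 0" using assms(2) by (auto simp: vec_eq_iff forall_2)
    then have "x$1 = p$1" using e True by simp
    then show thesis using ne True by (intro that[of "(x$2 - p$2)/(q$2 - p$2)"]) simp_all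
  next
    case False
    then have "x$2 - p$2 = (x$1 - p$1)/(q$1 - p$1) * (q$2 - p$2)"
      using e by (simp add: field_simps)
    then show thesis using False by (intro that[of "(x$1 - p$1)/(q$1 - p$1)"]) simp_all
  qed
  then have "x = (1 - t) *\<^sub>R p + t *\<^sub>R q"
    by (simp add: vec_eq_iff forall_2 algebra_simps)
  then show thesis by (rule that)
qed

text \<open>The Pluecker relation of the three vectors from \<open>a\<close> to \<open>x\<close>, \<open>y\<close>, \<open>z\<close> and the vector from \<open>a\<close> to \<open>b\<close>. It makes the
angular order around \<open>a\<close> transitive on the half-plane to the left of \<open>a b\<close>.\<close>
lemma orient_pluecker:
  "orient a b y * orient a x z = orient a b x * orient a y z + orient a b z * orient a x y"
  unfolding orient_def by algebra

lemma orient_barycentric_sum: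
  "orient b c z + orient c a z + orient a b z = orient a b c"
  unfolding orient_def by algebra

lemma orient_barycentric:
  "orient a b c *\<^sub>R z = orient b c z *\<^sub>R a + orient c a z *\<^sub>R b + orient a b z *\<^sub>R c"
proof -
  have "orient a b c * z$1 = orient b c z * a$1 + orient c a z * b$1 + orient a b z * c$1"
    "orient a b c * z$2 = orient b c z * a$2 + orient c a z * b$2 + orient a b z * c$2"
    unfolding orient_def by algebra+
  then show ?thesis by (simp add: vec_eq_iff forall_2)
qed

definition convex_position :: "(real^2) set \<Rightarrow> bool" where
  "convex_position V \<longleftrightarrow> finite V \<and> (\<forall>x\<in>V. x extreme_point_of (convex hull V))"

lemma extreme_point_of_subset:
  "x extreme_point_of S \<Longrightarrow> T \<subseteq> S \<Longrightarrow> x \<in> T \<Longrightarrow> x extreme_point_of T"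
  unfolding extreme_point_of_def by blast

lemma convex_position_subset:
  assumes "convex_position V" "T \<subseteq> V" shows "convex_position T"
  using assms unfolding convex_position_def
  by (meson extreme_point_of_subset finite_subset hull_inc hull_mono subsetD)

lemma vertices_convex_hull:
  assumes "convex_position V" shows "vertices (convex hull V) = V"
  using assms extreme_point_of_convex_hull unfolding vertices_def convex_position_def by blast

lemma convex_position_vertices:
  assumes "polytope P" shows "convex_position (vertices P)" "convex hull (vertices P) = P"
proof -
  show h: "convex hull (vertices P) = P"
    using Krein_Milman_Minkowski[of P] assms
    by (simp add: vertices_def polytope_imp_compact polytope_imp_convex)
  have "finite (vertices P)"
    unfolding vertices_def using finite_polyhedron_extreme_points[of P] assms
    by (simp add: polytope_imp_polyhedron)
  then show "convex_position (vertices P)"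
    unfolding convex_position_def h by (simp add: vertices_def)
qed

lemma extreme_in_hull_subset:
  assumes "convex_position V" "T \<subseteq> V" "x \<in> V" "x \<in> convex hull T" shows "x \<in> T"
  using assms unfolding convex_position_def
  by (meson extreme_point_of_convex_hull extreme_point_of_subset hull_mono)

lemma extreme_not_in_open_segment:
  assumes "convex_position V" "x \<in> V" "y \<in> convex hull V" "z \<in> convex hull V"
  shows "x \<notin> open_segment y z"
  using assms unfolding convex_position_def extreme_point_of_def by blast

text \<open>A point of the line outside the segment would have \<open>p\<close> or \<open>q\<close> between itself and the other end, and
these are extreme points.\<close>
lemma line_Int_hull:
  assumes V: "convex_position V" "p \<in> V" "q \<in> V" "p \<noteq> q"
    and x: "x \<in> convex hull V" "orient p q x = 0"
  shows "x \<in> closed_segment p q"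
proof -
  obtain t where t: "x = (1 - t) *\<^sub>R p + t *\<^sub>R q" using orient_zero_line x V by blast
  have pq: "p \<in> convex hull V" "q \<in> convex hull V" using V by (auto intro: hull_inc)
  consider "t < 0" | "t > 1" | "0 \<le> t" "t \<le> 1" by linarith
  then show ?thesis
  proof cases
    case 1
    \<comment> \<open>Solving for \<open>p\<close> exhibits it between \<open>x\<close> and \<open>q\<close>; the next case is symmetric.\<close>
    obtain r where r: "r * (1 - t) = 1" "0 < r" "r < 1"
      using 1 by (intro that[of "1 / (1 - t)"]) (auto simp: field_simps)
    have "r *\<^sub>R x + (1 - r) *\<^sub>R q = (r * (1 - t)) *\<^sub>R p + (1 - r * (1 - t)) *\<^sub>R q"
      unfolding t by (simp add: algebra_simps)
    then have "p = (1 - (1 - r)) *\<^sub>R x + (1 - r) *\<^sub>R q" unfolding r(1) by simp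
    moreover have "x \<noteq> q" 
    proof
      assume "x = q"
      then have "(1 - t) *\<^sub>R (p - q) = 0" using t by (simp add: algebra_simps)
      then show False using V 1 by simp
    qed
    ultimately have "p \<in> open_segment x q"
      unfolding in_segment using r by (intro conjI exI[of _ "1 - r"]) auto
    then show ?thesis using extreme_not_in_open_segment V x pq by blast
  next
    case 2
    obtain r where r: "r * t = 1" "0 < r" "r < 1"
      using 2 by (intro that[of "1 / t"]) (auto simp: field_simps)
    have "r *\<^sub>R x + (1 - r) *\<^sub>R p = (r * t) *\<^sub>R q + (1 - r * t) *\<^sub>R p"
      unfolding t by (simp add: algebra_simps)
    then have "q = (1 - (1 - r)) *\<^sub>R x + (1 - r) *\<^sub>R p" unfolding r(1) by simp
    moreover have "x \<noteq> p" 
    proof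
      assume "x = p"
      then have "t *\<^sub>R (q - p) = 0" using t by (simp add: algebra_simps)
      then show False using V 2 by simp
    qed
    ultimately have "q \<in> open_segment x p"
      unfolding in_segment using r by (intro conjI exI[of _ "1 - r"]) auto
    then show ?thesis using extreme_not_in_open_segment V x pq by blast
  next
    case 3
    then show ?thesis unfolding in_segment using t by blast
  qed
qed

lemma orient_nonzero:
  assumes "convex_position V" "p \<in> V" "q \<in> V" "z \<in> V" "p \<noteq> q" "p \<noteq> z" "q \<noteq> z"
  shows "orient p q z \<noteq> 0"
proof
  assume "orient p q z = 0"
  then have "z \<in> open_segment p q"
    using line_Int_hull[of V p q z] assms by (auto simp: open_segment_def intro: hull_inc)
  then show False using extreme_not_in_open_segment assms by (meson hull_inc)
qed

lemma orient_zero_cases: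
  assumes "convex_position V" "p \<in> V" "q \<in> V" "z \<in> V" "p \<noteq> q"
  shows "orient p q z = 0 \<longleftrightarrow> z = p \<or> z = q"
  using orient_nonzero[OF assms] by auto

lemma orient_crossing:
  assumes "orient p q y > 0" "orient p q z < 0"
  obtains x where "x \<in> open_segment y z" "orient p q x = 0"
proof -
  let ?s = "orient p q y / (orient p q y - orient p q z)"
  have s: "0 < ?s" "?s < 1" using assms by (auto simp: field_simps)
  let ?x = "(1 - ?s) *\<^sub>R y + ?s *\<^sub>R z"
  have "orient p q ?x = (1 - ?s) * orient p q y + ?s * orient p q z"
    by (rule orient_affine) simp
  also have "\<dots> = 0" using assms by (simp add: field_simps)
  finally have "orient p q ?x = 0" .
  moreover have "y \<noteq> z" using assms by auto
  then have "?x \<in> open_segment y z" unfolding in_segment using s by blast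
  ultimately show thesis using that by blast
qed

text \<open>A point \<open>x\<close> of the hull on the left side lies between a point \<open>y\<close> of the hull of the left vertices
and a point \<open>z\<close> of the hull of the right ones. The segment from \<open>y\<close> to \<open>z\<close> crosses the line in a point
of the segment from \<open>p\<close> to \<open>q\<close>, whose ends count as left vertices; \<open>x\<close> lies between \<open>y\<close> and this crossing.\<close>
lemma hull_halfplane:
  assumes V: "convex_position V" "p \<in> V" "q \<in> V" "p \<noteq> q"
  shows "convex hull V \<inter> {x. orient p q x \<ge> 0} = convex hull {z\<in>V. orient p q z \<ge> 0}"
    (is "_ = convex hull ?A")
proof
  show "convex hull ?A \<subseteq> convex hull V \<inter> {x. orient p q x \<ge> 0}"
    by (intro hull_minimal convex_Int convex_convex_hull convex_orient) (auto intro: hull_inc)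
  show "convex hull V \<inter> {x. orient p q x \<ge> 0} \<subseteq> convex hull ?A"
  proof safe
    fix x assume x: "x \<in> convex hull V" "orient p q x \<ge> 0"
    let ?B = "{z\<in>V. orient p q z \<le> 0}"
    have pq: "closed_segment p q \<subseteq> convex hull ?A"
      unfolding segment_convex_hull using V by (intro hull_mono) auto
    have "V = ?A \<union> ?B" by auto
    moreover have "?A \<noteq> {}" "?B \<noteq> {}" using V by (auto intro!: exI[of _ p])
    ultimately obtain u v y z where xyz: "u \<ge> 0" "v \<ge> 0" "u + v = 1" "y \<in> convex hull ?A"
        "z \<in> convex hull ?B" "x = u *\<^sub>R y + v *\<^sub>R z"
      using x(1) convex_hull_union_two[of "convex hull ?A" "convex hull ?B"]
        hull_Un[of convex ?A ?B, OF convex_Inter] by (auto simp: convex_hull_eq_empty)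
    have "convex hull ?A \<subseteq> {x. orient p q x \<ge> 0}" "convex hull ?B \<subseteq> {x. orient p q x \<le> 0}"
      by (intro hull_minimal convex_orient; auto)+
    then have y: "orient p q y \<ge> 0" and z: "orient p q z \<le> 0" using xyz by auto
    have zV: "z \<in> convex hull V" "y \<in> convex hull V" using xyz hull_mono[of ?B V] hull_mono[of ?A V]
      by auto
    show "x \<in> convex hull ?A"
    proof (cases "orient p q z = 0")
      case True
      then have "z \<in> convex hull ?A" using line_Int_hull V zV pq by blast
      then show ?thesis using xyz convexD[OF convex_convex_hull] by blast
    next
      case False
      then have zn: "orient p q z < 0" using z by simp
      have fx: "u * orient p q y + v * orient p q z \<ge> 0"
        using x(2) xyz orient_affine by simp
      show ?thesis
      proof (cases "orient p q y = 0")
        case True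
        then have "v = 0" using fx zn xyz by (auto simp: zero_le_mult_iff)
        then show ?thesis using xyz by simp
      next
        case False
        then have yp: "orient p q y > 0" using y by simp
        let ?d = "orient p q y - orient p q z"
        \<comment> \<open>The crossing divides the segment from \<open>y\<close> to \<open>z\<close> in the ratio of the two orientations.\<close>
        define s where "s = orient p q y / ?d"
        let ?t = "(1 - s) *\<^sub>R y + s *\<^sub>R z"
        have d: "?d > 0" using yp zn by simp
        have "orient p q ?t = (1 - s) * orient p q y + s * orient p q z"
          by (rule orient_affine) simp
        also have "\<dots> = 0" using d by (simp add: s_def field_simps)
        finally have t0: "orient p q ?t = 0" .
        have s: "0 < s" "s \<le> 1" using yp zn by (auto simp: s_def field_simps)
        have "?t \<in> convex hull V"
          using s zV convexD[OF convex_convex_hull, of y V z "1 - s" s] by simp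
        then have tA: "?t \<in> convex hull ?A" using line_Int_hull V t0 pq by blast
        have "v * ?d \<le> orient p q y"
        proof -
          have "u = 1 - v" using xyz(3) by simp
          show ?thesis using fx unfolding \<open>u = 1 - v\<close> by (simp add: algebra_simps)
        qed
        then have vs: "v / s \<le> 1" using yp d by (simp add: s_def field_simps)
        have sd: "s \<noteq> 0" using s(1) by (metis less_irrefl)
        have "x = (1 - v / s) *\<^sub>R y + (v / s) *\<^sub>R ?t"
        proof -
          have c2: "(v / s) * s = v" using sd by simp
          have "(1 - w) + w * (1 - s) = 1 - w * s" for w s :: real by (simp add: algebra_simps)
          then have c1: "(1 - v / s) + (v / s) * (1 - s) = u" using c2 xyz(3) by (metis add_diff_cancel_right')
          have "(1 - v / s) *\<^sub>R y + (v / s) *\<^sub>R ?t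
            = ((1 - v / s) + (v / s) * (1 - s)) *\<^sub>R y + ((v / s) * s) *\<^sub>R z"
            by (simp only: scaleR_right_distrib scaleR_left_distrib scaleR_scaleR add.assoc)
          then show ?thesis unfolding c1 c2 using xyz by simp
        qed
        then show ?thesis
          using convexD[OF convex_convex_hull, of y ?A ?t "1 - v / s" "v / s"] xyz tA vs s
          by (simp del: divide_divide_eq_right)
      qed
    qed
  qed
qed

lemma open_hull_halfplane:
  assumes V: "convex_position V" "p \<in> V" "q \<in> V" "p \<noteq> q"
  shows "interior (convex hull {z\<in>V. orient p q z \<ge> 0}) = interior (convex hull V) \<inter> {x. orient p q x > 0}"
  unfolding hull_halfplane[OF V, symmetric] interior_Int interior_orient[OF V(4)] ..

lemma open_hull_halfplane':
  assumes V: "convex_position V" "p \<in> V" "q \<in> V" "p \<noteq> q"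
  shows "interior (convex hull {z\<in>V. orient p q z \<le> 0}) = interior (convex hull V) \<inter> {x. orient p q x < 0}"
  using open_hull_halfplane[of V q p] V by (simp add: orient_swap[of q p])

lemma open_hull_split:
  assumes V: "convex_position V" "p \<in> V" "q \<in> V" "p \<noteq> q"
  shows "interior (convex hull V) - closed_segment p q =
     interior (convex hull {z\<in>V. orient p q z \<ge> 0}) \<union> interior (convex hull {z\<in>V. orient p q z \<le> 0})"
proof -
  have "orient p q x = 0" if "x \<in> closed_segment p q" for x
  proof -
    have "closed_segment p q \<subseteq> {x. orient p q x = 0}"
      by (intro closed_segment_subset convex_orient) auto
    then show ?thesis using that by auto
  qed
  then show ?thesis
    unfolding open_hull_halfplane[OF V] open_hull_halfplane'[OF V]
    using line_Int_hull[OF V] interior_subset[of "convex hull V"] by (auto simp: less_le) 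
qed

text \<open>A nonzero vector \<open>n\<close> orthogonal to both sides of a triangle exists only if the triangle is degenerate.\<close>
lemma three_on_line:
  assumes "n \<noteq> (0::real^2)" "n \<bullet> p = b" "n \<bullet> q = b" "n \<bullet> z = b"
  shows "orient p q z = 0"
proof -
  have e: "n$1 * p$1 + n$2 * p$2 = b" "n$1 * q$1 + n$2 * q$2 = b" "n$1 * z$1 + n$2 * z$2 = b"
    using assms by (auto simp: inner_vec_def sum_2)
  have line: "n$1 * (q$1 - p$1) + n$2 * (q$2 - p$2) = 0" "n$1 * (z$1 - p$1) + n$2 * (z$2 - p$2) = 0"
    using e by (simp_all add: algebra_simps)
  have "n$1 * orient p q z = 0" "n$2 * orient p q z = 0"
    using line(1) line(2) unfolding orient_def by algebra+
  moreover have "n$1 \<noteq> 0 \<or> n$2 \<noteq> 0" using assms(1) by (auto simp: vec_eq_iff forall_2)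
  ultimately show ?thesis by auto
qed

lemma open_hull_nonempty:
  assumes "convex_position V" "card V \<ge> 3"
  shows "interior (convex hull V) \<noteq> {}"
proof
  assume "interior (convex hull V) = {}"
  then obtain n b where nb: "n \<noteq> 0" "convex hull V \<subseteq> {x. n \<bullet> x = b}"
    using empty_interior_subset_hyperplane[of "convex hull V"] by auto
  obtain T where "T \<subseteq> V" "card T = 3" using obtain_subset_with_card_n[OF assms(2)] by metis
  then obtain p q z where "p \<in> V" "q \<in> V" "z \<in> V" "p \<noteq> q" "p \<noteq> z" "q \<noteq> z"
    unfolding card_3_iff by auto
  moreover from this have "orient p q z = 0"
    using nb by (intro three_on_line[OF nb(1), of p b]) (auto dest: hull_inc subsetD)
  ultimately show False using orient_nonzero assms(1) by blast
qed

lemma closure_open_hull: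
  assumes "convex_position V" "card V \<ge> 3"
  shows "closure (interior (convex hull V)) = convex hull V"
proof -
  have "compact (convex hull V)" using assms
    by (simp add: convex_position_def finite_imp_compact_convex_hull)
  then show ?thesis using convex_closure_interior[OF convex_convex_hull open_hull_nonempty[OF assms]]
    by (simp add: compact_imp_closed)
qed

text \<open>A supporting line at a point of the open segment contains \<open>p\<close> and \<open>q\<close>, hence also the crossing of
\<open>p q\<close> with \<open>y z\<close>, hence \<open>y\<close>; but then \<open>p\<close>, \<open>q\<close>, \<open>y\<close> are collinear.\<close>
lemma diagonal_in_interior:
  assumes V: "convex_position V" "p \<in> V" "q \<in> V" "y \<in> V" "z \<in> V"
    and yz: "orient p q y > 0" "orient p q z < 0"
  shows "open_segment p q \<subseteq> interior (convex hull V)"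
proof
  fix x assume x: "x \<in> open_segment p q"
  have pq: "p \<noteq> q" using yz by auto
  have sub: "V \<subseteq> convex hull V" by (rule hull_subset)
  have xV: "x \<in> convex hull V"
    using x V convex_contains_open_segment[of "convex hull V"] by (meson convex_convex_hull hull_inc subsetD)
  have c3: "{p, q, y} \<subseteq> V" "card {p, q, y} = 3" using V yz pq by (auto simp: card_insert_if)
  then have "card V \<ge> 3" using card_mono[of V "{p, q, y}"] V by (auto simp: convex_position_def)
  then have ri: "rel_interior (convex hull V) = interior (convex hull V)"
    by (intro rel_interior_nonempty_interior open_hull_nonempty[OF V(1)])
  show "x \<in> interior (convex hull V)"
  proof (rule ccontr)
    assume "x \<notin> interior (convex hull V)"
    then have nri: "x \<notin> rel_interior (convex hull V)" unfolding ri .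
    have xc: "x \<in> closure (convex hull V)" using xV closure_subset by blast
    obtain n where n: "n \<noteq> 0" "\<And>w. w \<in> closure (convex hull V) \<Longrightarrow> n \<bullet> x \<le> n \<bullet> w"
      by (rule supporting_hyperplane_relative_frontier[OF convex_convex_hull xc nri]) (rule that, assumption, blast)
    have le: "n \<bullet> x \<le> n \<bullet> w" if "w \<in> V" for w
      using n(2) that sub closure_subset by (meson subsetD)
    have key: "n \<bullet> r = n \<bullet> w \<and> n \<bullet> s = n \<bullet> w"
      if w: "w \<in> open_segment r s" and l: "n \<bullet> w \<le> n \<bullet> r" "n \<bullet> w \<le> n \<bullet> s" for w r s
    proof -
      obtain u where u: "0 < u" "u < 1" "w = (1-u) *\<^sub>R r + u *\<^sub>R s" using w in_segment by metis
      then have "n \<bullet> w = (1-u) * (n \<bullet> r) + u * (n \<bullet> s)" by (simp add: inner_right_distrib)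
      then have "(1-u) * (n \<bullet> r - n \<bullet> w) + u * (n \<bullet> s - n \<bullet> w) = 0" by (simp add: algebra_simps)
      moreover have "(1-u) * (n \<bullet> r - n \<bullet> w) \<ge> 0" "u * (n \<bullet> s - n \<bullet> w) \<ge> 0" using u l by auto
      ultimately have "(1-u) * (n \<bullet> r - n \<bullet> w) = 0" "u * (n \<bullet> s - n \<bullet> w) = 0" by linarith+
      then show ?thesis using u by simp
    qed
    have pqx: "n \<bullet> p = n \<bullet> x" "n \<bullet> q = n \<bullet> x" using key[OF x] le V by auto
    obtain t where t: "t \<in> open_segment y z" "orient p q t = 0" using orient_crossing yz by blast
    have "t \<in> convex hull V"
      using t V convex_contains_open_segment[of "convex hull V"] by (meson convex_convex_hull hull_inc subsetD)
    then have "t \<in> closed_segment p q" using line_Int_hull V pq t by blast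
    then have "t \<in> {w. n \<bullet> w = n \<bullet> x}"
      using closed_segment_subset[OF _ _ convex_hyperplane[where a=n and b="n \<bullet> x"], of p q] pqx by auto
    then have "n \<bullet> y = n \<bullet> x" using key[OF t(1)] le V by auto
    then have "orient p q y = 0" using three_on_line[OF n(1)] pqx by blast
    then show False using yz by simp
  qed
qed

section \<open>Dissections and the vertex sets of their cells\<close>

text \<open>For a cell \<open>T\<close> this is the open region with vertex set \<open>T\<close>.\<close>
abbreviation open_hull :: "(real^2) set \<Rightarrow> (real^2) set" where
  "open_hull T \<equiv> interior (convex hull T)"

text \<open>The chords of the polygon, in a form that does not mention faces; \<open>chords_eq_diagonals\<close> relates the two.\<close>
definition diagonals :: "(real^2) set \<Rightarrow> (real^2) set set" where
  "diagonals V = {closed_segment p q | p q. p \<in> V \<and> q \<in> V \<and>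
     (\<exists>z\<in>V. orient p q z > 0) \<and> (\<exists>z\<in>V. orient p q z < 0)}"

text \<open>Crossing is expressed by relative interiors, i.e. by the open segments, and not by the interior of the
polygon, so that the same set of chords can be regarded as a dissection of a smaller polygon.\<close>
definition dissection :: "(real^2) set \<Rightarrow> (real^2) set set \<Rightarrow> bool" where
  "dissection V D \<longleftrightarrow> D \<subseteq> diagonals V \<and>
     (\<forall>c\<in>D. \<forall>c'\<in>D. c \<noteq> c' \<longrightarrow> rel_interior c \<inter> rel_interior c' = {})"

text \<open>A cell is the vertex set of the closure of a component.\<close>
definition cells :: "(real^2) set \<Rightarrow> (real^2) set set \<Rightarrow> (real^2) set set" where
  "cells V D = (\<lambda>R. vertices (closure R)) ` components (open_hull V - \<Union>D)"

text \<open>A certificate for the components: a family of disjoint, open and connected sets that covers an open set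
consists of its components (\<open>tiling_cells\<close>).\<close>
definition tiling :: "(real^2) set \<Rightarrow> (real^2) set set \<Rightarrow> (real^2) set set \<Rightarrow> bool" where
  "tiling V D C \<longleftrightarrow> (\<forall>T\<in>C. T \<subseteq> V \<and> 3 \<le> card T) \<and>
     (\<forall>T\<in>C. \<forall>T'\<in>C. T \<noteq> T' \<longrightarrow> open_hull T \<inter> open_hull T' = {}) \<and>
     (\<Union>T\<in>C. open_hull T) = open_hull V - \<Union>D"

lemma diagonalE:
  assumes "c \<in> diagonals V"
  obtains p q where "c = closed_segment p q" "p \<in> V" "q \<in> V" "p \<noteq> q"
    "\<exists>z\<in>V. orient p q z > 0" "\<exists>z\<in>V. orient p q z < 0"
proof -
  obtain p q where pq: "c = closed_segment p q" "p \<in> V" "q \<in> V"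
    "\<exists>z\<in>V. orient p q z > 0" "\<exists>z\<in>V. orient p q z < 0"
    using assms unfolding diagonals_def by blast
  from pq(4) have "p \<noteq> q" by auto
  then show thesis using pq by (intro that)
qed

lemma diagonal_ends:
  assumes "closed_segment p q \<in> diagonals V"
  shows "p \<in> V" "q \<in> V" "p \<noteq> q" "\<exists>z\<in>V. orient p q z > 0" "\<exists>z\<in>V. orient p q z < 0"
proof -
  \<comment> \<open>A segment determines its ends only up to order.\<close>
  obtain r s where rs: "closed_segment p q = closed_segment r s" "r \<in> V" "s \<in> V" "r \<noteq> s"
    "\<exists>z\<in>V. orient r s z > 0" "\<exists>z\<in>V. orient r s z < 0"
    by (rule diagonalE[OF assms])
  from rs(1) have "{p, q} = {r, s}" by (rule closed_segment_eq[THEN iffD1])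
  then consider "p = r" "q = s" | "p = s" "q = r" unfolding doubleton_eq_iff by blast
  then have "p \<in> V \<and> q \<in> V \<and> p \<noteq> q \<and> (\<exists>z\<in>V. orient p q z > 0) \<and> (\<exists>z\<in>V. orient p q z < 0)"
  proof cases
    case 1
    then show ?thesis using rs(2-) by blast
  next
    case 2
    have "orient p q z = - orient r s z" for z unfolding 2 by (rule orient_swap)
    then show ?thesis unfolding 2(1)[symmetric] 2(2)[symmetric] using rs(2-) unfolding 2 by simp
  qed
  then show "p \<in> V" "q \<in> V" "p \<noteq> q" "\<exists>z\<in>V. orient p q z > 0" "\<exists>z\<in>V. orient p q z < 0"
    by blast+
qed

lemma rel_interior_segment: "p \<noteq> q \<Longrightarrow> rel_interior (closed_segment p q) = open_segment p q"
  for p q :: "real^2"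
  by (simp add: rel_interior_closed_segment)

lemma finite_diagonals:
  assumes "convex_position V" shows "finite (diagonals V)"
proof (rule finite_subset)
  show "finite ((\<lambda>e. closed_segment (fst e) (snd e)) ` (V \<times> V))"
    using assms by (simp add: convex_position_def)
  show "diagonals V \<subseteq> (\<lambda>e. closed_segment (fst e) (snd e)) ` (V \<times> V)"
  proof (rule subsetI)
    fix c assume "c \<in> diagonals V"
    then obtain p q where c: "c = closed_segment p q" "p \<in> V" "q \<in> V" by (rule diagonalE)
    show "c \<in> (\<lambda>e. closed_segment (fst e) (snd e)) ` (V \<times> V)"
      by (rule image_eqI[where x = "(p, q)"]) (simp_all only: c fst_conv snd_conv mem_Sigma_iff simp_thms)
  qed
qed

lemma dissectionD:
  assumes "dissection V D"
  shows "D \<subseteq> diagonals V" "\<And>c. c \<in> D \<Longrightarrow> c \<in> diagonals V"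
    "\<And>c c'. c \<in> D \<Longrightarrow> c' \<in> D \<Longrightarrow> c \<noteq> c' \<Longrightarrow> rel_interior c \<inter> rel_interior c' = {}"
proof -
  show D: "D \<subseteq> diagonals V" using assms by (simp only: dissection_def)
  show "c \<in> diagonals V" if "c \<in> D" for c using D that by (rule subsetD)
  have "\<forall>c\<in>D. \<forall>c'\<in>D. c \<noteq> c' \<longrightarrow> rel_interior c \<inter> rel_interior c' = {}"
    by (rule conjunct2[OF assms[unfolded dissection_def]])
  then show "rel_interior c \<inter> rel_interior c' = {}" if "c \<in> D" "c' \<in> D" "c \<noteq> c'" for c c'
    using that by simp
qed

lemma dissection_subset:
  assumes "dissection V D" "D' \<subseteq> D" shows "dissection V D'"
  unfolding dissection_def
proof (intro conjI ballI impI)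
  show "D' \<subseteq> diagonals V" using dissectionD(1)[OF assms(1)] assms(2) by (rule subset_trans[rotated])
  show "rel_interior c \<inter> rel_interior c' = {}" if "c \<in> D'" "c' \<in> D'" "c \<noteq> c'" for c c'
    using that assms(2) by (intro dissectionD(3)[OF assms(1)]) (simp_all add: subsetD)
qed

lemma dissection_finite: "convex_position V \<Longrightarrow> dissection V D \<Longrightarrow> finite D"
  by (rule finite_subset[OF dissectionD(1) finite_diagonals])

lemma tilingD:
  assumes "tiling V D C"
  shows "\<And>T. T \<in> C \<Longrightarrow> T \<subseteq> V" "\<And>T. T \<in> C \<Longrightarrow> 3 \<le> card T"
    "\<And>T T'. T \<in> C \<Longrightarrow> T' \<in> C \<Longrightarrow> T \<noteq> T' \<Longrightarrow> open_hull T \<inter> open_hull T' = {}"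
    "(\<Union>T\<in>C. open_hull T) = open_hull V - \<Union>D"
  using assms unfolding tiling_def by simp_all

lemma tiling_components:
  assumes V: "convex_position V" and t: "tiling V D C"
  shows "components (open_hull V - \<Union>D) = open_hull ` C"
proof (rule components_open_unique)
  show "pairwise disjnt (open_hull ` C)"
    using t unfolding tiling_def pairwise_def disjnt_def by (metis (no_types, lifting) imageE)
  show "\<Union> (open_hull ` C) = open_hull V - \<Union>D" using t by (simp add: tiling_def)
  fix X assume "X \<in> open_hull ` C"
  then obtain T where T: "T \<in> C" "X = open_hull T" by blast
  then have "open_hull T \<noteq> {}"
    using open_hull_nonempty convex_position_subset[OF V] tilingD(1,2)[OF t] T by blast
  then show "open X \<and> connected X \<and> X \<noteq> {}"
    unfolding T by (simp add: convex_connected convex_interior)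
qed

lemma tiling_cells:
  assumes V: "convex_position V" and t: "tiling V D C"
  shows "cells V D = C"
proof -
  have "vertices (closure (open_hull T)) = T" if "T \<in> C" for T
    using closure_open_hull vertices_convex_hull convex_position_subset[OF V] tilingD(1,2)[OF t that]
    by simp
  then show ?thesis unfolding cells_def tiling_components[OF assms] image_image by simp
qed

lemma tiling_empty:
  assumes "card V \<ge> 3" shows "tiling V {} {V}"
  using assms unfolding tiling_def by auto

lemma tiling_replace:
  assumes t: "tiling V D C" and T: "T \<in> C"
    and AB: "A \<subseteq> T" "B \<subseteq> T" "3 \<le> card A" "3 \<le> card B" "open_hull A \<inter> open_hull B = {}"
    and c: "open_hull T - c = open_hull A \<union> open_hull B"
    and cS: "\<And>S. S \<in> C \<Longrightarrow> S \<noteq> T \<Longrightarrow> open_hull S \<inter> c = {}"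
  shows "tiling V (insert c D) (insert A (insert B (C - {T})))"
  unfolding tiling_def
proof (intro conjI)
  show "\<forall>S\<in>insert A (insert B (C - {T})). S \<subseteq> V \<and> 3 \<le> card S"
    using tilingD(1,2)[OF t] T AB by blast
  have d2: "open_hull A \<inter> open_hull R = {}" "open_hull B \<inter> open_hull R = {}" if "R \<in> C" "R \<noteq> T" for R
    using tilingD(3)[OF t T that(1)] that(2) c by blast+
  have "pairwise (\<lambda>S S'. open_hull S \<inter> open_hull S' = {}) (C - {T})"
    using tilingD(3)[OF t] by (simp add: pairwise_def)
  then have "pairwise (\<lambda>S S'. open_hull S \<inter> open_hull S' = {}) (insert A (insert B (C - {T})))"
    using AB(5) AB(5)[unfolded Int_commute[of "open_hull A"]] d2 d2[unfolded Int_commute[of "open_hull A"] Int_commute[of "open_hull B"]]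
    by (simp add: pairwise_insert) metis
  then show "\<forall>S\<in>insert A (insert B (C - {T})). \<forall>S'\<in>insert A (insert B (C - {T})).
      S \<noteq> S' \<longrightarrow> open_hull S \<inter> open_hull S' = {}"
    by (simp only: pairwise_def)
  have "open_hull V - \<Union>(insert c D) = (\<Union>S\<in>C. open_hull S) - c"
    unfolding tilingD(4)[OF t] by blast
  also have "\<dots> = (open_hull T - c) \<union> ((\<Union>S\<in>C - {T}. open_hull S) - c)" using T by blast
  also have "(\<Union>S\<in>C - {T}. open_hull S) - c = (\<Union>S\<in>C - {T}. open_hull S)" using cS by blast
  finally show "(\<Union>S\<in>insert A (insert B (C - {T})). open_hull S) = open_hull V - \<Union>(insert c D)"
    unfolding c by (simp add: Un_assoc)
qed

text \<open>The open chord is connected and avoids the old chords, so it lies in one region \<open>open_hull T\<close>. Its ends lie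
in the closure of this region and are extreme points of the polygon, so they belong to \<open>T\<close>; and \<open>T\<close> has
vertices strictly on both sides, because an interior point of its hull lies on the line of the chord.\<close>
lemma tiling_split:
  assumes V: "convex_position V" and t: "tiling V D C"
    and d: "dissection V (insert (closed_segment p q) D)" "closed_segment p q \<notin> D"
  obtains T where "T \<in> C" "p \<in> T" "q \<in> T" "\<exists>z\<in>T. orient p q z > 0" "\<exists>z\<in>T. orient p q z < 0"
    "{z\<in>T. orient p q z \<ge> 0} \<notin> C" "{z\<in>T. orient p q z \<le> 0} \<notin> C"
    "tiling V (insert (closed_segment p q) D)
       (insert {z\<in>T. orient p q z \<ge> 0} (insert {z\<in>T. orient p q z \<le> 0} (C - {T})))"
proof -
  let ?c = "closed_segment p q"
  have dg: "?c \<in> diagonals V" by (rule dissectionD(2)[OF d(1)]) simp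
  note pq = diagonal_ends[OF dg]
  have sub: "open_segment p q \<subseteq> open_hull V" using diagonal_in_interior V pq by blast
  \<comment> \<open>An old chord could only meet the new one in an end of the old chord, but that is an extreme point.\<close>
  have "open_segment p q \<inter> c = {}" if c: "c \<in> D" for c
  proof -
    have "c \<in> diagonals V" by (rule dissectionD(2)[OF d(1)]) (simp add: c)
    then obtain r s where rs: "c = closed_segment r s" "r \<in> V" "s \<in> V" "r \<noteq> s"
      by (rule diagonalE)
    have "rel_interior ?c \<inter> rel_interior c = {}"
      by (rule dissectionD(3)[OF d(1)]) (use c d(2) in auto)
    then have "open_segment p q \<inter> open_segment r s = {}"
      unfolding rs(1) rel_interior_segment[OF pq(3)] rel_interior_segment[OF rs(4)] .
    moreover have "r \<notin> open_segment p q" "s \<notin> open_segment p q"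
      by (rule extreme_not_in_open_segment[OF V]; simp add: rs(2,3) pq(1,2) hull_inc)+
    ultimately have "open_segment p q \<inter> (open_segment r s \<union> {r, s}) = {}" by simp
    then show ?thesis unfolding rs(1) closed_segment_eq_open .
  qed
  then have "open_segment p q \<inter> \<Union>D = {}" by (simp add: Int_Union)
  then have sub2: "open_segment p q \<subseteq> open_hull V - \<Union>D" using sub by blast
  have ne: "open_segment p q \<noteq> {}" using pq by simp
  then obtain m where m: "m \<in> open_segment p q" by blast
  then have "m \<in> (\<Union>T\<in>C. open_hull T)" using sub2 unfolding tilingD(4)[OF t] by (rule subsetD[rotated])
  then obtain T where T: "m \<in> open_segment p q" "T \<in> C" "m \<in> open_hull T" using m by blast
  have "open_hull T \<in> components (open_hull V - \<Union>D)" using T tiling_components[OF V t] by simp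
  moreover have "open_hull T \<inter> open_segment p q \<noteq> {}" using T by blast
  ultimately have oT: "open_segment p q \<subseteq> open_hull T"
    by (intro components_maximal[OF _ _ sub2] convex_connected convex_open_segment)
  have TV: "T \<subseteq> V" "3 \<le> card T" using T tilingD[OF t] by auto
  have cT: "convex_position T" by (rule convex_position_subset[OF V TV(1)])
  have "closed_segment p q = closure (open_segment p q)" using pq by simp
  also have "\<dots> \<subseteq> closure (open_hull T)" using oT by (rule closure_mono)
  also have "\<dots> = convex hull T" by (rule closure_open_hull[OF cT TV(2)])
  finally have cTs: "closed_segment p q \<subseteq> convex hull T" .
  then have pT: "p \<in> T" "q \<in> T" using extreme_in_hull_subset[OF V TV(1)] pq(1,2) by auto
  have m0: "orient p q m = 0"
    using T(1) closed_segment_subset[OF _ _ convex_orient(4)[of p q], of p q] open_closed_segment by auto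
  let ?A = "{z\<in>T. orient p q z \<ge> 0}" and ?B = "{z\<in>T. orient p q z \<le> 0}"
  have iA: "open_hull ?A = open_hull T \<inter> {x. orient p q x > 0}"
    by (rule open_hull_halfplane[OF cT pT pq(3)])
  have iB: "open_hull ?B = open_hull T \<inter> {x. orient p q x < 0}"
    by (rule open_hull_halfplane'[OF cT pT pq(3)])
  have iAB: "open_hull T - ?c = open_hull ?A \<union> open_hull ?B"
    by (rule open_hull_split[OF cT pT pq(3)])
  have pos: "\<exists>z\<in>T. orient p q z > 0"
  proof (rule ccontr)
    assume "\<not> ?thesis"
    then have "?B = T" by force
    then have "m \<in> open_hull ?B" using T(3) by simp
    then show False unfolding iB using m0 by simp
  qed
  have neg: "\<exists>z\<in>T. orient p q z < 0"
  proof (rule ccontr)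
    assume "\<not> ?thesis"
    then have "?A = T" by force
    then have "m \<in> open_hull ?A" using T(3) by simp
    then show False unfolding iA using m0 by simp
  qed
  have fT: "finite T" using cT by (simp add: convex_position_def)
  have big: "3 \<le> card S" if "S \<subseteq> T" "p \<in> S" "q \<in> S" "z \<in> S" "orient p q z \<noteq> 0" for S z
  proof -
    have "card {p, q, z} = 3" using that pq by (auto simp: card_insert_if)
    then show ?thesis using card_mono[of S "{p,q,z}"] that fT finite_subset by fastforce
  qed
  obtain y z where yz: "y \<in> T" "orient p q y > 0" "z \<in> T" "orient p q z < 0" using pos neg by blast
  have A3: "3 \<le> card ?A" by (rule big[of _ y]) (use yz pT in simp_all)
  have B3: "3 \<le> card ?B" by (rule big[of _ z]) (use yz pT in simp_all)
  have nA: "open_hull ?A \<noteq> {}" and nB: "open_hull ?B \<noteq> {}"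
    by (intro open_hull_nonempty A3 B3 convex_position_subset[OF cT] Collect_restrict)+
  have disj: "open_hull T \<inter> open_hull S = {}" if "S \<in> C" "S \<noteq> T" for S
    using tilingD(3)[OF t that(1) T(2) that(2)] by (simp only: Int_commute)
  have "z \<notin> ?A" "y \<notin> ?B" using yz by simp_all
  then have "?A \<noteq> T" "?B \<noteq> T" using yz(1,3) by metis+
  then have AC: "?A \<notin> C" and BC: "?B \<notin> C"
    using disj[of ?A] disj[of ?B] nA nB unfolding iA iB by blast+
  have cS: "open_hull S \<inter> ?c = {}" if S: "S \<in> C" "S \<noteq> T" for S
  proof -
    have "open_hull S \<inter> closure (open_hull T) = {}"
      using disj[OF S] by (simp add: open_Int_closure_eq_empty Int_commute)
    then show ?thesis unfolding closure_open_hull[OF cT TV(2)] using cTs by blast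
  qed
  have "open_hull ?A \<inter> open_hull ?B = {}" unfolding iA iB by auto
  from tiling_replace[OF t T(2) Collect_restrict Collect_restrict A3 B3 this iAB cS]
  have "tiling V (insert ?c D) (insert ?A (insert ?B (C - {T})))" .
  then show thesis using that T(2) pT pos neg AC BC by blast
qed

lemma dissection_tiling:
  assumes V: "convex_position V" "card V \<ge> 3" and D: "dissection V D"
  shows "tiling V D (cells V D)"
proof -
  have "\<exists>C. tiling V D C"
    using dissection_finite[OF V(1) D] D
  proof (induction D rule: finite_induct)
    case empty
    then show ?case using tiling_empty[OF V(2)] by blast
  next
    case (insert c D)
    then have "dissection V D" using dissection_subset by blast
    then obtain C where C: "tiling V D C" using insert.IH by blast
    have "c \<in> diagonals V" by (rule dissectionD(2)[OF insert.prems]) simp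
    then obtain p q where "c = closed_segment p q" by (rule diagonalE)
    then show ?case using tiling_split[OF V(1) C, of p q] insert by metis
  qed
  then show ?thesis using tiling_cells[OF V(1)] by blast
qed

lemma cells_insert:
  assumes V: "convex_position V" "card V \<ge> 3"
    and d: "dissection V (insert (closed_segment p q) D)" "closed_segment p q \<notin> D"
  obtains T where "T \<in> cells V D" "p \<in> T" "q \<in> T" "\<exists>z\<in>T. orient p q z > 0" "\<exists>z\<in>T. orient p q z < 0"
    "{z\<in>T. orient p q z \<ge> 0} \<notin> cells V D" "{z\<in>T. orient p q z \<le> 0} \<notin> cells V D"
    "cells V (insert (closed_segment p q) D) =
       insert {z\<in>T. orient p q z \<ge> 0} (insert {z\<in>T. orient p q z \<le> 0} (cells V D - {T}))"
proof -
  have "dissection V D" using d dissection_subset by blast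
  note t = dissection_tiling[OF V this]
  show thesis by (rule tiling_split[OF V(1) t d]) (rule that; (assumption | rule tiling_cells[OF V(1)])+)
qed

lemma cells_empty: "convex_position V \<Longrightarrow> card V \<ge> 3 \<Longrightarrow> cells V {} = {V}"
  by (rule tiling_cells[OF _ tiling_empty])

lemma dissection_induct [consumes 3, case_names empty insert]:
  assumes V: "convex_position V" "card V \<ge> 3" and D: "dissection V D"
    and e: "Q {} {V}"
    and i: "\<And>p q D T. dissection V (insert (closed_segment p q) D) \<Longrightarrow> closed_segment p q \<notin> D \<Longrightarrow>
      Q D (cells V D) \<Longrightarrow> T \<in> cells V D \<Longrightarrow> T \<subseteq> V \<Longrightarrow> p \<in> T \<Longrightarrow> q \<in> T \<Longrightarrow> p \<noteq> q \<Longrightarrow>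
      \<exists>z\<in>T. orient p q z > 0 \<Longrightarrow> \<exists>z\<in>T. orient p q z < 0 \<Longrightarrow>
      {z\<in>T. orient p q z \<ge> 0} \<notin> cells V D \<Longrightarrow> {z\<in>T. orient p q z \<le> 0} \<notin> cells V D \<Longrightarrow>
      Q (insert (closed_segment p q) D)
        (insert {z\<in>T. orient p q z \<ge> 0} (insert {z\<in>T. orient p q z \<le> 0} (cells V D - {T})))"
  shows "Q D (cells V D)"
  using dissection_finite[OF V(1) D] D
proof (induction D rule: finite_induct)
  case empty
  then show ?case using e cells_empty[OF V] by simp
next
  case (insert c D)
  then have D: "dissection V D" using dissection_subset by blast
  have "c \<in> diagonals V" by (rule dissectionD(2)[OF insert.prems]) simp
  then obtain p q where c: "c = closed_segment p q" "p \<noteq> q" by (rule diagonalE)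
  note ins = insert.prems[unfolded c] insert.hyps(2)[unfolded c]
  obtain T where T: "T \<in> cells V D" "p \<in> T" "q \<in> T" "\<exists>z\<in>T. orient p q z > 0" "\<exists>z\<in>T. orient p q z < 0"
    "{z\<in>T. orient p q z \<ge> 0} \<notin> cells V D" "{z\<in>T. orient p q z \<le> 0} \<notin> cells V D"
    "cells V (insert (closed_segment p q) D) =
       insert {z\<in>T. orient p q z \<ge> 0} (insert {z\<in>T. orient p q z \<le> 0} (cells V D - {T}))"
    by (rule cells_insert[OF V ins])
  have "T \<subseteq> V" by (rule tilingD(1)[OF dissection_tiling[OF V D] T(1)])
  then show ?case unfolding c T(8) using i[OF ins insert.IH[OF D]] T c(2) by blast
qed

section \<open>Properties of cells, by induction on the chords\<close>

lemma open_segment_subset_hull: "p \<in> S \<Longrightarrow> q \<in> S \<Longrightarrow> open_segment p q \<subseteq> convex hull S"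
  by (meson convex_contains_open_segment convex_convex_hull hull_inc)

lemma card_halfplanes:
  assumes T: "convex_position T" "p \<in> T" "q \<in> T" "p \<noteq> q"
  shows "card {z\<in>T. orient p q z \<ge> 0} + card {z\<in>T. orient p q z \<le> 0} = card T + 2"
proof -
  let ?A = "{z\<in>T. orient p q z \<ge> 0}" and ?B = "{z\<in>T. orient p q z \<le> 0}"
  have f: "finite ?A" "finite ?B" using T(1) by (auto simp: convex_position_def)
  have "?A \<union> ?B = T" by auto
  moreover have "?A \<inter> ?B = {z\<in>T. orient p q z = 0}" by auto
  moreover have "\<dots> = {p, q}" using orient_zero_cases[OF T(1-3) _ T(4)] T by auto
  ultimately show ?thesis using card_Un_Int[OF f] T(4) by simp
qed

lemma cellsD:
  assumes "convex_position V" "card V \<ge> 3" "dissection V D" "T \<in> cells V D"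
  shows "T \<subseteq> V" "3 \<le> card T" "convex_position T" "finite T"
    "open_hull T \<subseteq> open_hull V - \<Union>D" "closure (open_hull T) = convex hull T"
proof -
  note t = tilingD[OF dissection_tiling[OF assms(1-3)]]
  show *: "T \<subseteq> V" "3 \<le> card T" by (rule t(1,2)[OF assms(4)])+
  show c: "convex_position T" by (rule convex_position_subset[OF assms(1) *(1)])
  then show "finite T" by (simp add: convex_position_def)
  show "closure (open_hull T) = convex hull T" by (rule closure_open_hull[OF c *(2)])
  show "open_hull T \<subseteq> open_hull V - \<Union>D" unfolding t(4)[symmetric] using assms(4) by blast
qed

lemma cells_disjoint:
  assumes "convex_position V" "card V \<ge> 3" "dissection V D" "S \<in> cells V D" "T \<in> cells V D"
    "open_hull S \<inter> convex hull T \<noteq> {}"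
  shows "S = T"
proof (rule ccontr)
  assume "S \<noteq> T"
  then have "open_hull S \<inter> open_hull T = {}"
    by (rule tilingD(3)[OF dissection_tiling[OF assms(1-3)] assms(4,5)])
  then have "open_hull S \<inter> closure (open_hull T) = {}" by (simp add: open_Int_closure_eq_empty)
  then show False using assms(6) unfolding cellsD(6)[OF assms(1-3,5)] by blast
qed

lemma finite_cells:
  assumes "convex_position V" "card V \<ge> 3" "dissection V D"
  shows "finite (cells V D)"
proof (rule finite_subset)
  show "cells V D \<subseteq> Pow V" using cellsD(1)[OF assms] by blast
  show "finite (Pow V)" using assms(1) by (simp add: convex_position_def)
qed

text \<open>The segment is a diagonal of \<open>S\<close>, so its inner points belong to the region of \<open>S\<close> and to the closure of the region of
\<open>T\<close>.\<close>
lemma cells_share_diagonal: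
  assumes V: "convex_position V" "card V \<ge> 3" "dissection V D" and S: "S \<in> cells V D" and T: "T \<in> cells V D"
    and pq: "p \<in> S" "q \<in> S" "p \<in> T" "q \<in> T" "y \<in> S" "z \<in> S" "orient p q y > 0" "orient p q z < 0"
  shows "S = T"
proof (rule cells_disjoint[OF V S T])
  have "open_segment p q \<subseteq> open_hull S"
    by (rule diagonal_in_interior[OF cellsD(3)[OF V S]]) (fact pq)+
  moreover have "open_segment p q \<subseteq> convex hull T"
    by (rule open_segment_subset_hull) (fact pq(3,4))+
  moreover have "p \<noteq> q" using pq(7) by auto
  then have "open_segment p q \<noteq> {}" by simp
  ultimately show "open_hull S \<inter> convex hull T \<noteq> {}" by blast
qed

text \<open>Splitting a cell by a diagonal duplicates the two ends of the diagonal. Equivalently, a triangulation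
of an \<open>m\<close>-gon has \<open>m - 2\<close> triangles.\<close>
lemma sum_cells:
  assumes V: "convex_position V" "card V \<ge> 3" "dissection V D"
  shows "(\<Sum>T\<in>cells V D. card T - 2) = card V - 2"
  using V
proof (induct rule: dissection_induct[where Q = "\<lambda>D C. (\<Sum>T\<in>C. card T - 2) = card V - 2"])
  case empty
  then show ?case by simp
next
  case (insert p q D T)
  let ?A = "{z\<in>T. orient p q z \<ge> 0}" and ?B = "{z\<in>T. orient p q z \<le> 0}"
  have D: "dissection V D" using insert(1) by (rule dissection_subset) auto
  have fin: "finite (cells V D)" by (rule finite_cells[OF V(1,2) D])
  have T: "convex_position T" "3 \<le> card T" "finite T" by (rule cellsD[OF V(1,2) D insert(4)])+
  have "?A \<noteq> ?B"
  proof
    assume eq: "?A = ?B"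
    obtain z where "z \<in> T" "orient p q z > 0" using insert(9) by blast
    then have "z \<in> ?A" "z \<notin> ?B" by simp_all
    then show False unfolding eq by simp
  qed
  then have "(\<Sum>T\<in>insert ?A (insert ?B (cells V D - {T})). card T - 2)
      = (card ?A - 2) + ((card ?B - 2) + (\<Sum>T\<in>cells V D - {T}. card T - 2))"
    using fin insert(11,12) by (subst sum.insert; simp)+
  also have "(\<Sum>T\<in>cells V D - {T}. card T - 2) = card V - 2 - (card T - 2)"
    unfolding insert(3)[symmetric] using sum.remove[OF fin insert(4), of "\<lambda>T. card T - 2"] by simp
  also have "card T - 2 \<le> card V - 2"
    unfolding insert(3)[symmetric] using sum.remove[OF fin insert(4), of "\<lambda>T. card T - 2"] by simp
  then have "(card ?A - 2) + ((card ?B - 2) + (card V - 2 - (card T - 2))) = card V - 2"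
  proof -
    have "card {p, q} \<le> card ?A" "card {p, q} \<le> card ?B"
      using insert(6,7) T(3) by (intro card_mono; simp)+
    then have "2 \<le> card ?A" "2 \<le> card ?B" using insert(8) by simp_all
    then show ?thesis
      using card_halfplanes[OF T(1) insert(6-8)] \<open>card T - 2 \<le> card V - 2\<close> T(2) by linarith
  qed
  finally show ?case .
qed

text \<open>A side \<open>a b\<close> of the polygon cannot cross the line through two vertices \<open>p\<close>, \<open>q\<close>: the crossing would
lie on the segment from \<open>p\<close> to \<open>q\<close>, which is strictly on the left of \<open>a b\<close>.\<close>
lemma edge_same_side:
  assumes V: "convex_position V" "a \<in> V" "b \<in> V" "p \<in> V" "q \<in> V" "a \<noteq> b"
    and e: "\<forall>z\<in>V. orient a b z \<ge> 0"
    and pq: "orient p q a > 0" "orient p q b < 0"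
  shows False
proof -
  have ne: "p \<noteq> a" "q \<noteq> a" "p \<noteq> b" "q \<noteq> b" "p \<noteq> q" using pq by auto
  have "orient a b p \<noteq> 0" "orient a b q \<noteq> 0"
    using orient_nonzero[OF V(1-3) V(4)] orient_nonzero[OF V(1-3) V(5)] ne V(6) by metis+
  then have pos: "orient a b p > 0" "orient a b q > 0" using e V(4,5) by (simp_all add: less_le)
  obtain x where x: "x \<in> open_segment a b" "orient p q x = 0" by (rule orient_crossing[OF pq])
  have ab: "open_segment a b \<subseteq> convex hull V"
    by (rule open_segment_subset_hull) (fact V(2,3))+
  have "x \<in> closed_segment p q"
    by (rule line_Int_hull[OF V(1,4,5) ne(5)]) (use x ab in blast)+
  also have "\<dots> \<subseteq> {x. orient a b x > 0}"
    by (rule closed_segment_subset) (use pos convex_orient(3) in simp_all)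
  finally have "orient a b x > 0" by simp
  moreover have "closed_segment a b \<subseteq> {x. orient a b x = 0}"
    by (rule closed_segment_subset) (simp_all add: convex_orient(4))
  ultimately show False using x(1) open_closed_segment by force
qed

text \<open>When a cell containing the side \<open>a b\<close> is split by \<open>p q\<close>, both ends go to the same half by
\<open>edge_same_side\<close>. They cannot belong to both halves, since \<open>p q\<close> would then be the side \<open>a b\<close>, and a side
has no vertices to its right.\<close>
lemma root_cell:
  assumes V: "convex_position V" "card V \<ge> 3" "dissection V D"
    and ab: "a \<in> V" "b \<in> V" "a \<noteq> b" and e: "\<forall>z\<in>V. orient a b z \<ge> 0"
  shows "\<exists>!T. T \<in> cells V D \<and> a \<in> T \<and> b \<in> T"
  using V
proof (induct rule: dissection_induct[where Q = "\<lambda>D C. \<exists>!T. T \<in> C \<and> a \<in> T \<and> b \<in> T"])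
  case empty
  show ?case using ab(1,2) by blast
next
  case (insert p q D T)
  let ?A = "{z\<in>T. orient p q z \<ge> 0}" and ?B = "{z\<in>T. orient p q z \<le> 0}"
  have pqV: "p \<in> V" "q \<in> V" using insert(5-7) by auto
  obtain R where R: "R \<in> cells V D" "a \<in> R" "b \<in> R"
    and uniq: "\<And>S. S \<in> cells V D \<Longrightarrow> a \<in> S \<Longrightarrow> b \<in> S \<Longrightarrow> S = R"
    using insert(3) by (elim ex1E conjE) (metis (no_types, lifting))
  have side: "orient p q a \<ge> 0 \<and> orient p q b \<ge> 0 \<or> orient p q a \<le> 0 \<and> orient p q b \<le> 0"
  proof (rule ccontr)
    assume "\<not> ?thesis"
    then consider "orient p q a > 0" "orient p q b < 0" | "orient p q a < 0" "orient p q b > 0"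
      by linarith
    then show False
    proof cases
      case 1
      then show False by (rule edge_same_side[OF V(1) ab(1,2) pqV ab(3) e])
    next
      case 2
      then have "orient q p a > 0" "orient q p b < 0" by (simp_all add: orient_swap[of q p])
      then show False by (rule edge_same_side[OF V(1) ab(1,2) pqV(2,1) ab(3) e])
    qed
  qed
  have notboth: False if "a \<in> ?A" "b \<in> ?A" "a \<in> ?B" "b \<in> ?B"
  proof -
    have "orient p q a = 0" "orient p q b = 0" using that by simp_all
    then have "a = p \<or> a = q" "b = p \<or> b = q"
      using orient_zero_cases[OF V(1) pqV ab(1) insert(8)] orient_zero_cases[OF V(1) pqV ab(2) insert(8)] by simp_all
    then consider "a = p" "b = q" | "a = q" "b = p" using ab(3) by metis
    then have "(\<forall>z\<in>V. orient p q z \<ge> 0) \<or> (\<forall>z\<in>V. orient p q z \<le> 0)"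
    proof cases
      case 1
      then show ?thesis using e by simp
    next
      case 2
      have "orient p q z \<le> 0" if "z \<in> V" for z
        using e that orient_swap[of p q z] unfolding 2 by simp
      then show ?thesis by simp
    qed
    then show False using insert(5,9,10) by (meson not_less subsetD)
  qed
  show ?case
  proof (cases "R = T")
    case True
    then have T: "a \<in> T" "b \<in> T" using R by simp_all
    have other: "S = T" if "S \<in> cells V D" "a \<in> S" "b \<in> S" for S using uniq that True by simp
    consider "a \<in> ?A" "b \<in> ?A" | "a \<in> ?B" "b \<in> ?B" using side T by auto
    then show ?thesis
    proof cases
      case 1
      show ?thesis
      proof (rule ex1I[of _ ?A])
        fix S assume "S \<in> insert ?A (insert ?B (cells V D - {T})) \<and> a \<in> S \<and> b \<in> S"
        then show "S = ?A" using other[of S] notboth 1 by blast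
      qed (use 1 in simp)
    next
      case 2
      show ?thesis
      proof (rule ex1I[of _ ?B])
        fix S assume "S \<in> insert ?A (insert ?B (cells V D - {T})) \<and> a \<in> S \<and> b \<in> S"
        then show "S = ?B" using other[of S] notboth 2 by blast
      qed (use 2 in simp)
    qed
  next
    case False
    have "\<not> (a \<in> T \<and> b \<in> T)" using uniq[OF insert(4)] False by metis
    then have "\<not> (a \<in> ?A \<and> b \<in> ?A)" "\<not> (a \<in> ?B \<and> b \<in> ?B)" by auto
    show ?thesis
    proof (rule ex1I[of _ R])
      show "R \<in> insert ?A (insert ?B (cells V D - {T})) \<and> a \<in> R \<and> b \<in> R"
        using R False by simp
      fix S assume S: "S \<in> insert ?A (insert ?B (cells V D - {T})) \<and> a \<in> S \<and> b \<in> S"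
      then have "S \<noteq> ?A" "S \<noteq> ?B"
        using \<open>\<not> (a \<in> ?A \<and> b \<in> ?A)\<close> \<open>\<not> (a \<in> ?B \<and> b \<in> ?B)\<close> by metis+
      then have "S \<in> cells V D" using S by (simp only: insert_iff Diff_iff) simp
      then show "S = R" using S by (intro uniq) simp_all
    qed
  qed
qed

text \<open>The only new side of the half of a split cell is the splitting diagonal. If \<open>x y\<close> is a side of the half but has
a vertex \<open>z\<close> of the cell to its right, then \<open>z\<close> lies beyond \<open>p q\<close>. An end of \<open>x y\<close> other than \<open>p\<close>
and \<open>q\<close> would be joined to \<open>z\<close> by a segment that crosses \<open>p q\<close> in a point to the right of \<open>x y\<close>,
although \<open>p\<close> and \<open>q\<close> belong to the half.\<close>
lemma halfplane_edge:
  assumes T: "convex_position T" "p \<in> T" "q \<in> T" "p \<noteq> q"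
    and xy: "x \<in> T" "y \<in> T" "x \<noteq> y" "orient p q x \<ge> 0" "orient p q y \<ge> 0"
    and e: "\<And>z. z \<in> T \<Longrightarrow> orient p q z \<ge> 0 \<Longrightarrow> orient x y z \<ge> 0"
    and z: "z \<in> T" "orient x y z < 0"
  shows "closed_segment x y = closed_segment p q"
proof -
  have zn: "orient p q z < 0" using e[OF z(1)] z(2) by linarith
  have pq: "orient x y t \<ge> 0" if "t \<in> closed_segment p q" for t
  proof -
    have "closed_segment p q \<subseteq> {t. orient x y t \<ge> 0}"
      by (rule closed_segment_subset) (use e T(2,3) convex_orient(1) in simp_all)
    then show ?thesis using that by auto
  qed
  have *: "w = p \<or> w = q" if w: "w = x \<or> w = y" for w
  proof (rule ccontr)
    assume ne: "\<not> (w = p \<or> w = q)"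
    have wT: "w \<in> T" "orient p q w \<ge> 0" using w xy by auto
    then have "orient p q w > 0"
      using ne orient_zero_cases[OF T(1-3) wT(1) T(4)] by (simp add: less_le)
    then obtain t where t: "t \<in> open_segment w z" "orient p q t = 0" using zn by (rule orient_crossing)
    have "open_segment w z \<subseteq> convex hull T"
      by (rule open_segment_subset_hull) (fact wT(1) z(1))+
    then have "t \<in> closed_segment p q" using t by (intro line_Int_hull[OF T]) auto
    then have t0: "orient x y t \<ge> 0" by (rule pq)
    obtain u where u: "0 < u" "t = (1 - u) *\<^sub>R w + u *\<^sub>R z" using t(1) in_segment(2) by metis
    have "orient x y w = 0" using w by auto
    then have "orient x y t = u * orient x y z"
      unfolding u(2) using orient_affine[of "1 - u" u x y w z] by simp
    also have "\<dots> < 0" using u(1) z(2) by (rule mult_pos_neg)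
    finally show False using t0 by simp
  qed
  have "x = p \<and> y = q \<or> x = q \<and> y = p" using *[of x] *[of y] xy(3) by metis
  then show ?thesis using closed_segment_commute by metis
qed

lemma cell_edges:
  assumes V: "convex_position V" "card V \<ge> 3" "dissection V D"
    and T: "T \<in> cells V D" "x \<in> T" "y \<in> T" "x \<noteq> y" "\<forall>z\<in>T. orient x y z \<ge> 0"
  shows "closed_segment x y \<in> D \<or> (\<forall>z\<in>V. orient x y z \<ge> 0)"
proof -
  let ?E = "\<lambda>D T. \<forall>x\<in>T. \<forall>y\<in>T. x \<noteq> y \<longrightarrow> (\<forall>z\<in>T. orient x y z \<ge> 0) \<longrightarrow>
    closed_segment x y \<in> D \<or> (\<forall>z\<in>V. orient x y z \<ge> 0)"
  have "\<forall>T\<in>cells V D. ?E D T"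
    using V
  proof (induct rule: dissection_induct[where Q = "\<lambda>D C. \<forall>T\<in>C. ?E D T"])
    case empty
    show ?case by simp
  next
    case (insert p q D T)
    let ?c = "closed_segment p q"
    let ?A = "{z\<in>T. orient p q z \<ge> 0}" and ?B = "{z\<in>T. orient p q z \<le> 0}"
    have D: "dissection V D" using insert(1) by (rule dissection_subset) auto
    have cT: "convex_position T" by (rule cellsD[OF V(1,2) D insert(4)])
    have IH: "?E D T" using insert(3,4) by (rule bspec)
    have half: "closed_segment x y \<in> insert ?c D \<or> (\<forall>z\<in>V. orient x y z \<ge> 0)"
      if rs: "r \<in> T" "s \<in> T" "r \<noteq> s" "closed_segment r s = ?c"
      and x: "x \<in> T" "y \<in> T" "x \<noteq> y" "orient r s x \<ge> 0" "orient r s y \<ge> 0"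
      and e: "\<And>z. z \<in> T \<Longrightarrow> orient r s z \<ge> 0 \<Longrightarrow> orient x y z \<ge> 0" for r s x y
    proof (cases "\<forall>z\<in>T. orient x y z \<ge> 0")
      case True
      then have "closed_segment x y \<in> D \<or> (\<forall>z\<in>V. orient x y z \<ge> 0)" using IH x(1-3) by simp
      then show ?thesis by (elim disjE) simp_all
    next
      case False
      then obtain z where z: "z \<in> T" "orient x y z < 0" by (meson not_le)
      have "closed_segment x y = closed_segment r s"
        by (rule halfplane_edge[OF cT rs(1-3) x e z])
      then show ?thesis unfolding rs(4) by (metis insertI1)
    qed
    show ?case
    proof (intro ballI impI)
      fix S x y
      assume S: "S \<in> insert ?A (insert ?B (cells V D - {T}))" and x: "x \<in> S" "y \<in> S" "x \<noteq> y"
        and e: "\<forall>z\<in>S. 0 \<le> orient x y z"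
      consider "S = ?A" | "S = ?B" | "S \<in> cells V D" using S by blast
      then show "closed_segment x y \<in> insert ?c D \<or> (\<forall>z\<in>V. orient x y z \<ge> 0)"
      proof cases
        case 1
        show ?thesis by (rule half[OF insert(6-8) refl]) (use x e in \<open>simp_all add: 1\<close>)
      next
        case 2
        show ?thesis
          by (rule half[OF insert(7,6) insert(8)[symmetric] closed_segment_commute])
            (use x e in \<open>simp_all add: 2 orient_swap[of q p]\<close>)
      next
        case 3
        with insert(3) have "?E D S" by (rule bspec)
        then have "closed_segment x y \<in> D \<or> (\<forall>z\<in>V. orient x y z \<ge> 0)" using x e by simp
        then show ?thesis by (elim disjE) simp_all
      qed
    qed
  qed
  then have "?E D T" using T(1) by (rule bspec)
  then show ?thesis using T(2-5) by simp
qed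

text \<open>The region of \<open>T\<close> is convex and avoids the chord, and inside the polygon the line through the chord is the chord.\<close>
lemma cell_one_side:
  assumes V: "convex_position V" "card V \<ge> 3" "dissection V D"
    and T: "T \<in> cells V D" and c: "closed_segment p q \<in> D"
  shows "(\<forall>z\<in>T. orient p q z \<ge> 0) \<or> (\<forall>z\<in>T. orient p q z \<le> 0)"
proof (rule ccontr)
  assume "\<not> ?thesis"
  then obtain y z where yz: "y \<in> T" "orient p q y > 0" "z \<in> T" "orient p q z < 0"
    by (meson not_le)
  note d = diagonal_ends[OF dissectionD(2)[OF V(3) c]]
  have cl: "T \<subseteq> closure (open_hull T)" unfolding cellsD(6)[OF V T] by (rule hull_subset)
  have meets: "\<exists>w. w \<in> open_hull T \<and> w \<in> U" if "open U" "w \<in> T" "w \<in> U" for U w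
  proof -
    have "U \<inter> closure (open_hull T) \<noteq> {}" using that(2,3) cl by blast
    then have "U \<inter> open_hull T \<noteq> {}" unfolding open_Int_closure_eq_empty[OF that(1)] .
    then show ?thesis by blast
  qed
  obtain y' where y': "y' \<in> open_hull T" "orient p q y' > 0"
    using meets[OF open_orient yz(1), of p q] yz(2) by blast
  have "\<exists>w. w \<in> open_hull T \<and> w \<in> {x. orient q p x > 0}"
    by (rule meets[OF open_orient yz(3)]) (use yz(4) in \<open>simp add: orient_swap[of q p]\<close>)
  then obtain z' where z': "z' \<in> open_hull T" "orient p q z' < 0" by (auto simp: orient_swap[of q p])
  obtain x where x: "x \<in> open_segment y' z'" "orient p q x = 0" by (rule orient_crossing[OF y'(2) z'(2)])
  have "convex (open_hull T)" by (simp add: convex_interior)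
  then have "open_segment y' z' \<subseteq> open_hull T" using y'(1) z'(1) unfolding convex_contains_open_segment by simp
  then have "x \<in> open_hull T" using x(1) by blast
  then have xV: "x \<in> open_hull V - \<Union>D" using cellsD(5)[OF V T] by blast
  then have "x \<in> convex hull V" using interior_subset by blast
  then have "x \<in> closed_segment p q" by (intro line_Int_hull[OF V(1) d(1-3)] x(2))
  then show False using xV c by blast
qed

section \<open>Regions of a plane polygon as cells\<close>

text \<open>If all vertices lie on one side, the line supports the polygon and cuts out a face. Conversely, if
\<open>y\<close> and \<open>z\<close> lie on different sides, their segment meets the segment \<open>p q\<close> in an inner point, so a face
containing \<open>p q\<close> would contain \<open>y\<close>.\<close>
lemma edge_of_hull_iff:
  assumes V: "convex_position V" "p \<in> V" "q \<in> V" "p \<noteq> q"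
  shows "closed_segment p q edge_of convex hull V \<longleftrightarrow>
    (\<forall>z\<in>V. orient p q z \<ge> 0) \<or> (\<forall>z\<in>V. orient p q z \<le> 0)"
proof
  assume e: "closed_segment p q edge_of convex hull V"
  show "(\<forall>z\<in>V. orient p q z \<ge> 0) \<or> (\<forall>z\<in>V. orient p q z \<le> 0)"
  proof (rule ccontr)
    assume "\<not> ?thesis"
    then obtain y z where yz: "y \<in> V" "orient p q y > 0" "z \<in> V" "orient p q z < 0"
      by (meson not_le)
    obtain t where t: "t \<in> open_segment y z" "orient p q t = 0" by (rule orient_crossing[OF yz(2,4)])
    have "t \<in> convex hull V" using t(1) open_segment_subset_hull[OF yz(1,3)] by blast
    then have tpq: "t \<in> closed_segment p q" by (rule line_Int_hull[OF V _ t(2)])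
    have "closed_segment p q face_of convex hull V" using e by (simp add: edge_of_def)
    then have "y \<in> closed_segment p q"
      by (rule face_ofD[OF _ t(1) _ _ tpq, THEN conjunct1]) (fact hull_inc[OF yz(1)] hull_inc[OF yz(3)])+
    moreover have "closed_segment p q \<subseteq> {x. orient p q x = 0}"
      by (rule closed_segment_subset) (simp_all add: convex_orient(4))
    ultimately show False using yz(2) by force
  qed
next
  have *: "closed_segment r s edge_of convex hull V"
    if rs: "r \<in> V" "s \<in> V" "r \<noteq> s" and ge: "\<forall>z\<in>V. orient r s z \<ge> 0" for r s
  proof -
    obtain n where n: "\<And>x. orient r s x = n \<bullet> x - n \<bullet> r" using orient_inner[of r s] by metis
    have "convex hull V \<subseteq> {x. orient r s x \<ge> 0}"
      by (rule hull_minimal) (use ge convex_orient(1) in auto)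
    then have "convex hull V \<inter> {x. n \<bullet> x = n \<bullet> r} face_of convex hull V"
      by (intro face_of_Int_supporting_hyperplane_ge convex_convex_hull) (auto simp: n)
    moreover have "convex hull V \<inter> {x. n \<bullet> x = n \<bullet> r} = closed_segment r s"
    proof
      show "convex hull V \<inter> {x. n \<bullet> x = n \<bullet> r} \<subseteq> closed_segment r s"
        using line_Int_hull[OF V(1) rs] by (auto simp: n)
      show "closed_segment r s \<subseteq> convex hull V \<inter> {x. n \<bullet> x = n \<bullet> r}"
        using rs n[of s] by (intro closed_segment_subset) (auto simp: hull_inc convex_Int convex_hyperplane)
    qed
    moreover have "aff_dim (closed_segment r s) = 1"
      using rs(3) by (simp add: segment_convex_hull aff_dim_convex_hull aff_dim_2)
    ultimately show ?thesis by (simp add: edge_of_def)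
  qed
  assume "(\<forall>z\<in>V. orient p q z \<ge> 0) \<or> (\<forall>z\<in>V. orient p q z \<le> 0)"
  then show "closed_segment p q edge_of convex hull V"
  proof
    assume "\<forall>z\<in>V. orient p q z \<le> 0"
    then have "closed_segment q p edge_of convex hull V"
      by (intro * V V(4)[symmetric]) (simp add: orient_swap[of q p])
    then show ?thesis by (simp only: closed_segment_commute)
  qed (intro * V)
qed

lemma edge_of_hullE:
  assumes V: "convex_position V" and e: "e edge_of convex hull V"
  obtains p q where "p \<in> V" "q \<in> V" "p \<noteq> q" "e = closed_segment p q"
proof -
  have f: "e face_of convex hull V" and d: "aff_dim e = 1" using e by (simp_all add: edge_of_def)
  have "compact V" using V by (simp add: convex_position_def finite_imp_compact)
  then obtain S where S: "S \<subseteq> V" "e = convex hull S" using face_of_convex_hull_subset[OF _ f] by metis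
  have cS: "convex_position S" by (rule convex_position_subset[OF V S(1)])
  have "card S < 3"
  proof (rule ccontr)
    assume "\<not> card S < 3"
    then have "interior e \<noteq> {}" using open_hull_nonempty[OF cS] S(2) by simp
    then show False using aff_dim_nonempty_interior[of e] d by simp
  qed
  moreover have "card S \<noteq> 0" "card S \<noteq> 1"
    using d cS unfolding S(2) by (auto simp: convex_position_def card_1_singleton_iff)
  ultimately have "card S = 2" by linarith
  then obtain p q where pq: "S = {p, q}" "p \<noteq> q" by (auto simp: card_2_iff)
  have "e = closed_segment p q" unfolding S(2) pq(1) segment_convex_hull ..
  moreover have "p \<in> V" "q \<in> V" using S(1) pq(1) by auto
  ultimately show thesis using pq(2) by (intro that)
qed

lemma chords_eq_diagonals:
  assumes V: "convex_position V"
  shows "chords (convex hull V) = diagonals V"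
proof -
  have "(a \<noteq> b \<and> \<not> closed_segment a b edge_of convex hull V) \<longleftrightarrow>
     (\<exists>z\<in>V. orient a b z > 0) \<and> (\<exists>z\<in>V. orient a b z < 0)" if ab: "a \<in> V" "b \<in> V" for a b
  proof (cases "a = b")
    case False
    then show ?thesis unfolding edge_of_hull_iff[OF V ab False] by (auto simp: not_le)
  qed simp
  then show ?thesis unfolding chords_def diagonals_def vertices_convex_hull[OF V]
    by (metis (no_types, lifting))
qed

lemma diagonal_Int_interior:
  assumes V: "convex_position V" and c: "c \<in> diagonals V"
  shows "c \<inter> open_hull V = rel_interior c"
proof -
  obtain p q where pq: "c = closed_segment p q" "p \<in> V" "q \<in> V" "p \<noteq> q"
    and yz: "\<exists>z\<in>V. orient p q z > 0" "\<exists>z\<in>V. orient p q z < 0" by (rule diagonalE[OF c])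
  obtain y z where "y \<in> V" "orient p q y > 0" "z \<in> V" "orient p q z < 0" using yz by blast
  then have "open_segment p q \<subseteq> open_hull V" by (intro diagonal_in_interior[OF V pq(2,3), of y z])
  moreover have "p \<notin> open_hull V" "q \<notin> open_hull V"
    using V pq(2,3) extreme_point_not_in_interior unfolding convex_position_def by blast+
  ultimately have "(open_segment p q \<union> {p, q}) \<inter> open_hull V = open_segment p q" by blast
  then show ?thesis
    unfolding pq(1) rel_interior_segment[OF pq(4)] unfolding closed_segment_eq_open[of p q] .
qed

lemma polygon_partition_iff:
  assumes V: "convex_position V"
  shows "polygon_partition (convex hull V) D \<longleftrightarrow> dissection V D"
proof -
  have "c \<inter> c' \<inter> open_hull V = rel_interior c \<inter> rel_interior c'" if "c \<in> diagonals V" "c' \<in> diagonals V" for c c'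
    unfolding diagonal_Int_interior[OF V that(1), symmetric] diagonal_Int_interior[OF V that(2), symmetric]
    by blast
  then show ?thesis
    unfolding polygon_partition_def dissection_def chords_eq_diagonals[OF V]
    by (intro conj_cong refl ball_cong imp_cong) (simp add: subset_iff)
qed

lemma Union_edges:
  assumes V: "convex_position V" "card V \<ge> 3"
  shows "\<Union>{e. e edge_of convex hull V} = convex hull V - open_hull V"
proof -
  note ne = open_hull_nonempty[OF V]
  have "polyhedron (convex hull V)"
    using V(1) by (simp add: convex_position_def polyhedron_convex_hull)
  moreover have "aff_dim (convex hull V) = 2" using aff_dim_nonempty_interior[OF ne] by simp
  then have "{e. e edge_of convex hull V} = {F. F facet_of convex hull V}"
    by (auto simp: edge_of_def facet_of_def)
  ultimately show ?thesis
    using rel_boundary_of_polyhedron[of "convex hull V"] rel_interior_nonempty_interior[OF ne] by simp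
qed

text \<open>The complement of the drawing is the disjoint union of the exterior of the polygon, which is connected
and unbounded, and of the regions of the cells.\<close>
lemma bounded_regions_eq:
  assumes V: "convex_position V" "card V \<ge> 3" "dissection V D"
  shows "bounded_regions (convex hull V) D = open_hull ` cells V D"
proof -
  let ?P = "convex hull V"
  have cP: "compact ?P" using V(1) by (simp add: convex_position_def finite_imp_compact_convex_hull)
  have "components (- \<Union>({e. e edge_of ?P} \<union> D)) = insert (- ?P) (open_hull ` cells V D)"
  proof (rule components_open_unique)
    have i: "open_hull V \<subseteq> ?P" by (rule interior_subset)
    note t = tilingD[OF dissection_tiling[OF V]]
    have sub: "open_hull T \<subseteq> ?P" if "T \<in> cells V D" for T using cellsD(5)[OF V that] i by blast
    have "pairwise disjnt (open_hull ` cells V D)"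
      unfolding pairwise_def disjnt_def
    proof (intro ballI impI)
      fix X Y assume "X \<in> open_hull ` cells V D" "Y \<in> open_hull ` cells V D" "X \<noteq> Y"
      then show "X \<inter> Y = {}" by (elim imageE) (simp, rule t(3), auto)
    qed
    then show "pairwise disjnt (insert (- ?P) (open_hull ` cells V D))"
      using sub unfolding pairwise_insert disjnt_def by blast
    \<comment> \<open>The sides make up the boundary, so the complement of the drawing splits into the exterior and an open part of the interior.\<close>
    have "\<Union>D \<subseteq> ?P"
    proof (rule Union_least)
      fix c assume "c \<in> D"
      then obtain p q where "c = closed_segment p q" "p \<in> V" "q \<in> V"
        using diagonalE[OF dissectionD(2)[OF V(3)]] by metis
      then show "c \<subseteq> ?P" by (simp add: closed_segment_subset hull_inc)
    qed
    then have "- \<Union>({e. e edge_of ?P} \<union> D) = - ?P \<union> (open_hull V - \<Union>D)"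
      unfolding Union_Un_distrib Union_edges[OF V(1,2)] using i by blast
    then show "\<Union>(insert (- ?P) (open_hull ` cells V D)) = - \<Union>({e. e edge_of ?P} \<union> D)"
      by (simp add: t(4))
    fix X assume "X \<in> insert (- ?P) (open_hull ` cells V D)"
    then consider "X = - ?P" | T where "T \<in> cells V D" "X = open_hull T" by blast
    then show "open X \<and> connected X \<and> X \<noteq> {}"
    proof cases
      case 1
      have "connected (- ?P)"
        by (rule connected_complement_bounded_convex) (simp_all add: compact_imp_bounded[OF cP])
      moreover have "?P \<noteq> UNIV" using compact_imp_bounded[OF cP] not_bounded_UNIV by metis
      ultimately show ?thesis using cP unfolding 1 by (auto simp: compact_imp_closed open_Compl)
    next
      case 2
      then show ?thesis using open_hull_nonempty[OF cellsD(3,2)[OF V 2(1)]]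
        by (simp add: convex_connected convex_interior)
    qed
  qed
  moreover have "\<not> bounded (- ?P)"
    using compact_imp_bounded[OF cP] cobounded_imp_unbounded by fastforce
  moreover have "bounded (open_hull T)" if "T \<in> cells V D" for T
  proof (rule bounded_subset[OF compact_imp_bounded[OF cP]])
    show "open_hull T \<subseteq> ?P" using cellsD(5)[OF V that] interior_subset[of ?P] by blast
  qed
  ultimately show ?thesis unfolding bounded_regions_def by auto
qed

text \<open>The combinatorial form of \<open>kd_partition\<close> for the root edge \<open>a b\<close>. For \<open>d = 1\<close> the cell at the root
edge has \<open>k + 1\<close> vertices like all others, as if \<open>d\<close> were \<open>k\<close>.\<close>
definition admissible ::
  "(real^2) set \<Rightarrow> real^2 \<Rightarrow> real^2 \<Rightarrow> nat \<Rightarrow> nat \<Rightarrow> (real^2) set set \<Rightarrow> bool" where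
  "admissible V a b k d D \<longleftrightarrow> dissection V D \<and> (\<forall>T\<in>cells V D.
     card T = (if a \<in> T \<and> b \<in> T then (if d = 1 then k else d) + 1 else k + 1))"

lemma convex_polygon_hull:
  assumes "convex_position T"
  shows "convex_polygon m (convex hull T) \<longleftrightarrow> card T = m"
  using assms unfolding convex_polygon_def vertices_convex_hull[OF assms]
  by (auto simp: convex_position_def polytope_convex_hull)

lemma segment_subset_hull:
  assumes "convex_position V" "T \<subseteq> V" "a \<in> V" "b \<in> V"
  shows "closed_segment a b \<subseteq> convex hull T \<longleftrightarrow> a \<in> T \<and> b \<in> T"
proof
  assume *: "closed_segment a b \<subseteq> convex hull T"
  have "a \<in> closed_segment a b" "b \<in> closed_segment a b" by simp_all
  then show "a \<in> T \<and> b \<in> T" using extreme_in_hull_subset[OF assms(1,2)] assms(3,4) * by blast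
next
  assume "a \<in> T \<and> b \<in> T"
  then show "closed_segment a b \<subseteq> convex hull T"
    by (intro closed_segment_subset) (simp_all add: hull_inc)
qed

lemma kd_partition_iff_admissible:
  assumes V: "convex_position V" "card V \<ge> 3" and ab: "a \<in> V" "b \<in> V" and d: "d \<ge> 1"
  shows "kd_partition (k + 1) (d + 1) (convex hull V) (closed_segment a b) D \<longleftrightarrow> admissible V a b k d D"
proof (cases "dissection V D")
  case True
  have 1: "convex_polygon m (closure (open_hull T)) \<longleftrightarrow> card T = m" if "T \<in> cells V D" for T m
    unfolding cellsD(6)[OF V True that] by (rule convex_polygon_hull[OF cellsD(3)[OF V True that]])
  have 2: "closed_segment a b \<subseteq> closure (open_hull T) \<longleftrightarrow> a \<in> T \<and> b \<in> T" if "T \<in> cells V D" for T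
    unfolding cellsD(6)[OF V True that] by (rule segment_subset_hull[OF V(1) cellsD(1)[OF V True that] ab])
  show ?thesis
    using d unfolding kd_partition_def admissible_def bounded_regions_eq[OF V True] polygon_partition_iff[OF V(1)]
    by (auto simp: 1 2)
next
  case False
  then show ?thesis unfolding kd_partition_def admissible_def polygon_partition_iff[OF V(1)] by simp
qed

section \<open>Vertices seen from an end of the root edge; cutting off an ear\<close>

lemma in_hull_3:
  "0 \<le> u \<Longrightarrow> 0 \<le> v \<Longrightarrow> 0 \<le> w \<Longrightarrow> u + v + w = 1 \<Longrightarrow> x = u *\<^sub>R a + v *\<^sub>R b + w *\<^sub>R c \<Longrightarrow>
    x \<in> convex hull {a, b, c}"
  unfolding convex_hull_3 by blast

text \<open>Fixing the orientation of the root edge makes \<open>\<lambda>x y. orient a x y > 0\<close> a linear order of the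
vertices other than \<open>a\<close>, the angular order around \<open>a\<close>. It starts with \<open>b\<close>.\<close>
locale rooted_polygon =
  fixes V :: "(real^2) set" and a b :: "real^2"
  assumes V: "convex_position V" and aV: "a \<in> V" and bV: "b \<in> V" and ab: "a \<noteq> b"
    and root: "\<And>z. z \<in> V \<Longrightarrow> orient a b z \<ge> 0"
begin

lemma root_pos: "z \<in> V \<Longrightarrow> z \<noteq> a \<Longrightarrow> z \<noteq> b \<Longrightarrow> orient a b z > 0"
  using root[of z] orient_nonzero[OF V aV bV _ ab] by (simp add: less_le)

lemma orient_total:
  assumes "x \<in> V" "y \<in> V" "x \<noteq> a" "y \<noteq> a" "x \<noteq> y"
  shows "orient a x y < 0 \<or> orient a x y > 0"
  using orient_nonzero[OF V aV assms(1,2)] assms(3-5) by (metis linorder_neqE_linordered_idom)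

lemma orient_trans:
  assumes "x \<in> V" "y \<in> V" "z \<in> V" "y \<noteq> a" "orient a x y > 0" "orient a y z \<ge> 0"
  shows "orient a x z \<ge> 0"
proof -
  have "y \<noteq> b"
  proof
    assume "y = b"
    then have "orient a b x < 0" using assms(5) orient_swap[of b a x] orient_rotate[of a x b] orient_rotate[of x b a]
      by simp
    then show False using root[OF assms(1)] by simp
  qed
  then have "orient a b y > 0" using root_pos assms(2,4) by simp
  moreover have "orient a b y * orient a x z \<ge> 0"
    unfolding orient_pluecker[of a b y x z] using root assms by simp
  ultimately show ?thesis by (simp add: zero_le_mult_iff)
qed

lemma orient_flip: "orient a x y = - orient a y x"
  unfolding orient_def by (simp add: algebra_simps)

text \<open>In a linear order, the number of elements from \<open>w\<close> on determines \<open>w\<close> and takes every possible value.\<close>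
lemma rank_bij:
  assumes S: "S \<subseteq> V - {a}"
  shows "bij_betw (\<lambda>w. card {z\<in>S. orient a w z \<ge> 0}) S {1..card S}"
proof -
  let ?r = "\<lambda>w. card {z\<in>S. orient a w z \<ge> 0}"
  have fS: "finite S" using V S finite_subset unfolding convex_position_def by blast
  \<comment> \<open>A later vertex has fewer vertices after it.\<close>
  have less: "?r y < ?r x" if xy: "x \<in> S" "y \<in> S" "orient a x y > 0" for x y
  proof (rule psubset_card_mono)
    show "finite {z\<in>S. orient a x z \<ge> 0}" using fS by simp
    have m: "x \<in> V" "y \<in> V" "y \<noteq> a" using xy S by auto
    have "{z\<in>S. orient a y z \<ge> 0} \<subseteq> {z\<in>S. orient a x z \<ge> 0}"
    proof (rule Collect_mono, rule impI, erule conjE, rule conjI)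
      fix z assume z: "z \<in> S" "orient a y z \<ge> 0"
      then have "z \<in> V" using S by auto
      then show "orient a x z \<ge> 0" using orient_trans[OF m(1,2) _ m(3) xy(3) z(2)] by simp
    qed
    moreover have "x \<in> {z\<in>S. orient a x z \<ge> 0}" "x \<notin> {z\<in>S. orient a y z \<ge> 0}"
      using xy orient_flip[of y x] by simp_all
    ultimately show "{z\<in>S. orient a y z \<ge> 0} \<subset> {z\<in>S. orient a x z \<ge> 0}" by blast
  qed
  have inj: "inj_on ?r S"
  proof (rule inj_onI, rule ccontr)
    fix x y assume xy: "x \<in> S" "y \<in> S" "?r x = ?r y" "x \<noteq> y"
    have "x \<in> V" "y \<in> V" "x \<noteq> a" "y \<noteq> a" using xy S by auto
    then have "orient a x y < 0 \<or> orient a x y > 0" using xy(4) by (rule orient_total)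
    then have "orient a y x > 0 \<or> orient a x y > 0" using orient_flip[of x y] by simp
    then show False using less[OF xy(1,2)] less[OF xy(2,1)] xy(3) by auto
  qed
  have "?r ` S \<subseteq> {1..card S}"
  proof (rule image_subsetI)
    fix x assume x: "x \<in> S"
    have "{x} \<subseteq> {z\<in>S. orient a x z \<ge> 0}" using x by simp
    then have "card {x} \<le> ?r x" by (rule card_mono[rotated]) (simp add: fS)
    moreover have "?r x \<le> card S" by (rule card_mono) (auto simp: fS)
    ultimately show "?r x \<in> {1..card S}" by simp
  qed
  then have "?r ` S = {1..card S}"
    by (rule card_subset_eq[rotated]) (simp_all add: card_image[OF inj])
  then show ?thesis using inj by (simp add: bij_betw_def)
qed

text \<open>The diagonal from \<open>a\<close> that cuts off \<open>k + 1\<close> vertices of \<open>T\<close>, counting its two ends, on the side away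
from \<open>b\<close>.\<close>
lemma split_point:
  assumes T: "T \<subseteq> V" "a \<in> T" and k: "1 \<le> k" "k + 1 \<le> card T"
  shows "\<exists>!w. w \<in> T \<and> w \<noteq> a \<and> card {z\<in>T. orient a w z \<ge> 0} = k + 1"
proof -
  let ?S = "T - {a}"
  have fT: "finite T" using V T finite_subset unfolding convex_position_def by blast
  have c: "card ?S = card T - 1" using T(2) fT by simp
  have r: "card {z\<in>T. orient a w z \<ge> 0} = card {z\<in>?S. orient a w z \<ge> 0} + 1" for w
  proof -
    have "{z\<in>T. orient a w z \<ge> 0} = insert a {z\<in>?S. orient a w z \<ge> 0}" using T(2) by auto
    then show ?thesis using fT by simp
  qed
  have bij: "bij_betw (\<lambda>w. card {z\<in>?S. orient a w z \<ge> 0}) ?S {1..card ?S}"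
    by (rule rank_bij) (use T in auto)
  have "k \<in> {1..card ?S}" using k c by auto
  then have "k \<in> (\<lambda>w. card {z\<in>?S. orient a w z \<ge> 0}) ` ?S" using bij_betw_imp_surj_on[OF bij] by simp
  then obtain w where w: "w \<in> ?S" "card {z\<in>?S. orient a w z \<ge> 0} = k" by (elim imageE) simp
  show ?thesis
  proof (rule ex1I[of _ w])
    show "w \<in> T \<and> w \<noteq> a \<and> card {z\<in>T. orient a w z \<ge> 0} = k + 1" unfolding r using w by simp
    fix u assume "u \<in> T \<and> u \<noteq> a \<and> card {z\<in>T. orient a u z \<ge> 0} = k + 1"
    then have "u \<in> ?S" "card {z\<in>?S. orient a u z \<ge> 0} = k" unfolding r by simp_all
    then show "u = w" by (intro inj_onD[OF bij_betw_imp_inj_on[OF bij] _ _ w(1)]) (simp_all only: w(2))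
  qed
qed

lemma last_vertex:
  assumes T: "T \<subseteq> V" "a \<in> T" "2 \<le> card T"
  obtains w where "w \<in> T" "w \<noteq> a" "\<And>z. z \<in> T \<Longrightarrow> z \<noteq> a \<Longrightarrow> z \<noteq> w \<Longrightarrow> orient a z w > 0"
proof -
  have "\<exists>!w. w \<in> T \<and> w \<noteq> a \<and> card {z\<in>T. orient a w z \<ge> 0} = 1 + 1"
    by (rule split_point[OF T(1,2)]) (use T(3) in simp_all)
  then obtain w where w: "w \<in> T" "w \<noteq> a" "card {z\<in>T. orient a w z \<ge> 0} = 2"
    unfolding one_add_one by (elim ex1E conjE)
  have "finite T" by (rule finite_subset[OF T(1)]) (use V in \<open>simp add: convex_position_def\<close>)
  then have f: "finite {z\<in>T. orient a w z \<ge> 0}" by simp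
  have eq: "{a, w} = {z\<in>T. orient a w z \<ge> 0}"
    by (rule card_subset_eq[OF f]) (use w T(2) in simp_all)
  have "orient a z w > 0" if z: "z \<in> T" "z \<noteq> a" "z \<noteq> w" for z
  proof -
    have "z \<notin> {z\<in>T. orient a w z \<ge> 0}" using z unfolding eq[symmetric] by simp
    then show ?thesis using z(1) orient_flip[of z w] by simp
  qed
  then show thesis using w by (intro that)
qed

lemma unique_root_cell:
  assumes "card V \<ge> 3" "dissection V D"
  shows "\<exists>!T. T \<in> cells V D \<and> a \<in> T \<and> b \<in> T"
  using root_cell[OF V assms aV bV ab] root by simp

lemma unique_root_cellD:
  assumes "card V \<ge> 3" "dissection V D" "S \<in> cells V D" "a \<in> S" "b \<in> S" "T \<in> cells V D" "a \<in> T" "b \<in> T"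
  shows "S = T"
  using unique_root_cell[OF assms(1,2)] assms(3-8) by (elim ex1E) metis

end

text \<open>The vertex \<open>v\<close> comes last in the angular order, so \<open>a v\<close> is the second side at \<open>a\<close>, and the triangle \<open>a b v\<close>
is an ear of the polygon. Its third side is a diagonal, as there is a fourth vertex.\<close>
locale rooted_polygon_with_ear = rooted_polygon +
  fixes v :: "real^2"
  assumes vV: "v \<in> V" and va: "v \<noteq> a" and last: "\<And>z. z \<in> V \<Longrightarrow> z \<noteq> a \<Longrightarrow> z \<noteq> v \<Longrightarrow> orient a z v > 0"
    and four: "card V \<ge> 4"
begin

abbreviation "c \<equiv> closed_segment v b"
abbreviation "V' \<equiv> V - {a}"

lemma three: "card V \<ge> 3" using four by simp

lemma finV: "finite V" using V by (simp add: convex_position_def)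

lemma vb: "v \<noteq> b"
proof
  assume "v = b"
  have "\<not> V \<subseteq> {a, b}"
  proof
    assume "V \<subseteq> {a, b}"
    then have "card V \<le> card {a, b}" by (intro card_mono) simp_all
    then show False using four ab by simp
  qed
  then obtain z where z: "z \<in> V" "z \<noteq> a" "z \<noteq> b" by blast
  then have "orient a z b > 0" using last \<open>v = b\<close> by simp
  then show False using root_pos[OF z] orient_flip[of z b] by simp
qed

lemma ear_neg: "orient v b a < 0"
  using root_pos[OF vV va vb] orient_rotate[of v b a] orient_rotate[of b a v] orient_flip[of v b] by simp

text \<open>A vertex on the other side would lie in the triangle \<open>a b v\<close>: its barycentric coordinates are
quotients of orientations, all of which are positive.\<close>
lemma ear_pos:
  assumes z: "z \<in> V" "z \<noteq> a" "z \<noteq> b" "z \<noteq> v"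
  shows "orient v b z > 0"
proof (rule ccontr)
  assume "\<not> ?thesis"
  moreover have "orient v b z \<noteq> 0" by (rule orient_nonzero[OF V vV bV z(1) vb]) (use z in auto)
  ultimately have c1: "orient b v z > 0" using orient_swap[of b v z] by linarith
  have c2: "orient v a z > 0"
    using last[OF z(1,2,4)] orient_swap[of v a z] orient_flip[of v z] by simp
  have c3: "orient a b z > 0" by (rule root_pos[OF z(1-3)])
  let ?s = "orient a b v"
  have s: "?s > 0" by (rule root_pos[OF vV va vb])
  have sum: "orient b v z + orient v a z + orient a b z = ?s" by (rule orient_barycentric_sum)
  have "z = (1/?s) *\<^sub>R (?s *\<^sub>R z)" using s by simp
  also have "\<dots> = (orient b v z / ?s) *\<^sub>R a + (orient v a z / ?s) *\<^sub>R b + (orient a b z / ?s) *\<^sub>R v"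
    unfolding orient_barycentric[of a b v z] by (simp add: scaleR_right_distrib)
  finally have eq: "z = (orient b v z / ?s) *\<^sub>R a + (orient v a z / ?s) *\<^sub>R b + (orient a b z / ?s) *\<^sub>R v" .
  have sum1: "orient b v z / ?s + orient v a z / ?s + orient a b z / ?s = 1"
    using sum s by (simp add: add_divide_distrib[symmetric])
  have nonneg: "0 \<le> orient b v z / ?s" "0 \<le> orient v a z / ?s" "0 \<le> orient a b z / ?s"
    using c1 c2 c3 s by simp_all
  have "z \<in> convex hull {a, b, v}" by (rule in_hull_3[OF nonneg sum1 eq])
  then have "z \<in> {a, b, v}"
    by (rule extreme_in_hull_subset[OF V _ z(1), rotated]) (use aV bV vV in simp)
  then show False using z by simp
qed

lemma ear_ge: "z \<in> V' \<Longrightarrow> orient v b z \<ge> 0"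
  using ear_pos[of z] by (cases "z = b \<or> z = v") auto

lemma ear_halfplanes:
  assumes "T \<subseteq> V"
  shows "{z\<in>T. orient v b z \<ge> 0} = T - {a}" "{z\<in>T. orient v b z \<le> 0} = T \<inter> {a, b, v}"
proof -
  show "{z\<in>T. orient v b z \<ge> 0} = T - {a}" using ear_ge ear_neg assms by fastforce
  have "z \<in> {a, b, v}" if "z \<in> T" "orient v b z \<le> 0" for z
    using ear_pos[of z] that assms by fastforce
  then show "{z\<in>T. orient v b z \<le> 0} = T \<inter> {a, b, v}" using ear_neg by auto
qed

lemma ex_pos: "\<exists>z\<in>V. orient v b z > 0"
proof -
  have "\<not> V \<subseteq> {a, b, v}"
  proof
    assume "V \<subseteq> {a, b, v}"
    then have "card V \<le> card {a, b, v}" by (intro card_mono) simp_all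
    also have "\<dots> \<le> 3" by (simp add: card_insert_if)
    finally show False using four by simp
  qed
  then obtain z where "z \<in> V" "z \<noteq> a" "z \<noteq> b" "z \<noteq> v" by blast
  then show ?thesis using ear_pos by blast
qed

lemma convex_position_V': "convex_position V'"
  by (rule convex_position_subset[OF V]) simp

lemma card_V': "card V' = card V - 1" "card V' \<ge> 3"
  using four aV finV by simp_all

lemma rooted_V': "rooted_polygon V' v b"
  by unfold_locales (use convex_position_V' vV va bV ab vb ear_ge in simp_all)

lemma open_hull_ear:
  "open_hull V - c = open_hull V' \<union> open_hull {a, b, v}"
  "open_hull {a, b, v} \<subseteq> {x. orient v b x < 0}" "convex hull V' \<subseteq> {x. orient v b x \<ge> 0}"
proof -
  have h: "{z\<in>V. orient v b z \<ge> 0} = V'" "{z\<in>V. orient v b z \<le> 0} = {a, b, v}"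
    using ear_halfplanes[of V] aV bV vV by auto
  show "open_hull V - c = open_hull V' \<union> open_hull {a, b, v}"
    using open_hull_split[OF V vV bV vb] unfolding h .
  show "open_hull {a, b, v} \<subseteq> {x. orient v b x < 0}"
    using open_hull_halfplane'[OF V vV bV vb] unfolding h by simp
  show "convex hull V' \<subseteq> {x. orient v b x \<ge> 0}"
    by (rule hull_minimal) (use ear_ge convex_orient(1) in auto)
qed

lemma ear_diagonal: "c \<in> diagonals V"
  unfolding diagonals_def using vV bV ex_pos ear_neg aV
  by (intro CollectI exI[of _ v] exI[of _ b] conjI refl) auto

lemma diagonals_mono: "S \<subseteq> T \<Longrightarrow> diagonals S \<subseteq> diagonals T"
proof (rule subsetI)
  fix e assume "S \<subseteq> T" "e \<in> diagonals S"
  then obtain p q where "e = closed_segment p q" "p \<in> T" "q \<in> T"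
    "\<exists>z\<in>T. orient p q z > 0" "\<exists>z\<in>T. orient p q z < 0"
    using diagonalE[OF \<open>e \<in> diagonals S\<close>] by (metis subsetD)
  then show "e \<in> diagonals T" unfolding diagonals_def by (intro CollectI exI[of _ p] exI[of _ q] conjI)
qed

text \<open>A dissection of the polygon without \<open>a\<close> lives on one side of the line through \<open>v\<close> and \<open>b\<close>, and the triangle \<open>a b v\<close> on the other.\<close>
lemma ear_insert:
  assumes E: "dissection V' E"
  shows "dissection V (insert c E)" "c \<notin> E" "cells V (insert c E) = insert {a, b, v} (cells V' E)"
proof -
  have ev: "e \<inter> open_hull V' = rel_interior e" if "e \<in> E" for e
    by (rule diagonal_Int_interior[OF convex_position_V' dissectionD(2)[OF E that]])
  have disj: "rel_interior e \<inter> c = {}" if "e \<in> E" for e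
    using open_hull_ear(1) unfolding ev[OF that, symmetric] by blast
  show "c \<notin> E"
  proof
    assume "c \<in> E"
    then have "\<exists>z\<in>V'. orient v b z < 0" by (rule diagonal_ends(5)[OF dissectionD(2)[OF E]])
    then show False using ear_ge by fastforce
  qed
  have cs: "rel_interior c \<subseteq> c" by (rule rel_interior_subset)
  show D: "dissection V (insert c E)"
    unfolding dissection_def
  proof (intro conjI ballI impI)
    show "insert c E \<subseteq> diagonals V"
      using ear_diagonal dissectionD(1)[OF E] diagonals_mono[of V' V] by blast
    fix e e' assume e: "e \<in> insert c E" "e' \<in> insert c E" "e \<noteq> e'"
    consider "e = c" "e' \<in> E" | "e' = c" "e \<in> E" | "e \<in> E" "e' \<in> E" using e by blast
    then show "rel_interior e \<inter> rel_interior e' = {}"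
    proof cases
      case 1
      then show ?thesis using disj[OF 1(2)] cs by blast
    next
      case 2
      then show ?thesis using disj[OF 2(2)] cs by blast
    next
      case 3
      then show ?thesis by (rule dissectionD(3)[OF E _ _ e(3)])
    qed
  qed
  note t = tilingD[OF dissection_tiling[OF convex_position_V' card_V'(2) E]]
  have "tiling V (insert c E) (insert {a, b, v} (cells V' E))"
    unfolding tiling_def
  proof (intro conjI)
    have "card {a, b, v} = 3" using ab va vb by auto
    then show "\<forall>T\<in>insert {a, b, v} (cells V' E). T \<subseteq> V \<and> 3 \<le> card T"
      using t(1,2) aV bV vV by auto
    have iV: "open_hull V' \<subseteq> {x. orient v b x \<ge> 0}"
      using open_hull_ear(3) interior_subset by blast
    have d: "open_hull {a, b, v} \<inter> open_hull T = {}" if "T \<in> cells V' E" for T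
    proof -
      have "open_hull T \<subseteq> open_hull V'" using t(4) that by blast
      then have "open_hull T \<subseteq> {x. orient v b x \<ge> 0}" using iV by blast
      then show ?thesis using open_hull_ear(2) by force
    qed
    show "\<forall>T\<in>insert {a, b, v} (cells V' E). \<forall>T'\<in>insert {a, b, v} (cells V' E).
        T \<noteq> T' \<longrightarrow> open_hull T \<inter> open_hull T' = {}"
      using d t(3) by (metis (no_types, lifting) Int_commute insertE)
    have "e \<inter> open_hull {a, b, v} = {}" if e: "e \<in> E" for e
    proof -
      obtain p q where pq: "e = closed_segment p q" "p \<in> V'" "q \<in> V'"
        using diagonalE[OF dissectionD(2)[OF E e]] by metis
      have "e \<subseteq> {x. orient v b x \<ge> 0}"
        unfolding pq(1) by (rule closed_segment_subset) (use ear_ge pq(2,3) convex_orient(1) in simp_all)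
      then show ?thesis using open_hull_ear(2) by force
    qed
    then have "open_hull {a, b, v} - \<Union>E = open_hull {a, b, v}" by blast
    then have "open_hull {a, b, v} \<union> (open_hull V' - \<Union>E) = open_hull V - \<Union>(insert c E)"
      using open_hull_ear(1) by blast
    then show "(\<Union>T\<in>insert {a, b, v} (cells V' E). open_hull T) = open_hull V - \<Union>(insert c E)"
      using t(4) by simp
  qed
  then show "cells V (insert c E) = insert {a, b, v} (cells V' E)" by (rule tiling_cells[OF V])
qed

text \<open>If the line through \<open>p\<close> and \<open>q\<close> separates \<open>a\<close> alone from the remaining vertices, then \<open>p q\<close> is the base of the ear: an end \<open>w\<close>
other than \<open>v\<close> and \<open>b\<close> lies beyond the base, so that the segment from \<open>w\<close> to \<open>a\<close> crosses the base in
a point on the side of \<open>a\<close>.\<close>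
lemma ear_side:
  assumes pq: "p \<in> V'" "q \<in> V'" "p \<noteq> q" and pos: "orient p q a > 0" and le: "\<And>z. z \<in> V' \<Longrightarrow> orient p q z \<le> 0"
  shows "closed_segment p q = c"
proof -
  have *: "w = v \<or> w = b" if w: "w = p \<or> w = q" for w
  proof (rule ccontr)
    assume ne: "\<not> (w = v \<or> w = b)"
    have wV: "w \<in> V" "w \<noteq> a" using w pq by auto
    have "orient v b w > 0" using ear_pos[OF wV] ne by simp
    then obtain x where x: "x \<in> open_segment w a" "orient v b x = 0"
      using ear_neg by (rule orient_crossing)
    have "x \<in> convex hull V" using x(1) open_segment_subset_hull[OF wV(1) aV] by blast
    then have "x \<in> c" by (rule line_Int_hull[OF V vV bV vb _ x(2)])
    moreover have "c \<subseteq> {x. orient p q x \<le> 0}"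
      by (rule closed_segment_subset) (use le vV va bV ab convex_orient(2) in simp_all)
    ultimately have x0: "orient p q x \<le> 0" by blast
    obtain u where u: "0 < u" "x = (1 - u) *\<^sub>R w + u *\<^sub>R a" using x(1) in_segment(2) by metis
    have "orient p q w = 0" using w by auto
    then have "orient p q x = u * orient p q a"
      unfolding u(2) using orient_affine[of "1 - u" u p q w a] by simp
    also have "\<dots> > 0" using u(1) pos by simp
    finally show False using x0 by simp
  qed
  have "p = v \<and> q = b \<or> p = b \<and> q = v" using *[of p] *[of q] pq(3) by metis
  then show ?thesis using closed_segment_commute by metis
qed

text \<open>A chord from \<open>a\<close> would separate \<open>b\<close> from \<open>v\<close>, which are vertices of a common cell. So all chords
other than the base of the ear remain chords when \<open>a\<close> is removed.\<close>
lemma ear_remove: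
  assumes D: "dissection V D" and T: "T \<in> cells V D" "a \<in> T" "b \<in> T" "v \<in> T"
  shows "dissection V' (D - {c})"
proof -
  have noa: False if e: "closed_segment a w \<in> D" for w
  proof -
    note d = diagonal_ends[OF dissectionD(2)[OF D e]]
    have "w \<noteq> b" using d(5) root by fastforce
    have "w \<noteq> v"
    proof
      assume "w = v"
      obtain z where z: "z \<in> V" "orient a v z > 0" using d(4) \<open>w = v\<close> by blast
      then have "orient a z v > 0" by (intro last) auto
      then show False using z(2) orient_flip[of z v] by simp
    qed
    have "orient a w v > 0" using last[OF d(2)] d(3) \<open>w \<noteq> v\<close> by simp
    moreover have "orient a w b < 0" using root_pos[OF d(2)] d(3) \<open>w \<noteq> b\<close> orient_flip[of w b] by simp
    ultimately show False using cell_one_side[OF V three D T(1) e] T(3,4) by fastforce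
  qed
  have "e \<in> diagonals V'" if e: "e \<in> D" "e \<noteq> c" for e
  proof -
    have "e \<in> diagonals V" by (rule dissectionD(2)[OF D e(1)])
    then obtain p q where pq: "e = closed_segment p q" "p \<in> V" "q \<in> V" "p \<noteq> q"
      "\<exists>z\<in>V. orient p q z > 0" "\<exists>z\<in>V. orient p q z < 0" by (rule diagonalE)
    have "p \<noteq> a" using noa[of q] e(1) pq(1) by metis
    moreover have "q \<noteq> a" using noa[of p] e(1) pq(1) closed_segment_commute[of p q] by metis
    ultimately have pV: "p \<in> V'" "q \<in> V'" using pq(2,3) by simp_all
    have "\<exists>z\<in>V'. orient p q z > 0"
    proof (rule ccontr)
      assume "\<not> ?thesis"
      then have le: "\<And>z. z \<in> V' \<Longrightarrow> orient p q z \<le> 0" by (meson not_le)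
      then have "orient p q a > 0" using pq(5) by (metis DiffI not_le singletonD)
      then have "closed_segment p q = c" using le by (rule ear_side[OF pV pq(4)])
      then show False using e(2) pq(1) by metis
    qed
    moreover have "\<exists>z\<in>V'. orient p q z < 0"
    proof (rule ccontr)
      assume n: "\<not> ?thesis"
      then have le: "\<And>z. z \<in> V' \<Longrightarrow> orient q p z \<le> 0" by (simp add: orient_swap[of q p] not_less)
      have "orient p q a < 0" using pq(6) n by (metis DiffI singletonD)
      then have "orient q p a > 0" by (simp add: orient_swap[of q p])
      then have "closed_segment q p = c" using le by (rule ear_side[OF pV(2,1) pq(4)[symmetric]])
      then show False using e(2) pq(1) closed_segment_commute[of p q] by metis
    qed
    ultimately show ?thesis
      unfolding pq(1) diagonals_def using pV by (intro CollectI exI[of _ p] exI[of _ q] conjI refl)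
  qed
  then show ?thesis
    unfolding dissection_def using dissectionD(3)[OF D] by simp blast
qed

text \<open>Adding the base of the ear to a dissection of the smaller polygon splits the cell at the root edge into the ear and the new root cell.\<close>
lemma ear_cells:
  assumes E: "dissection V' E"
  obtains T where "T \<in> cells V E" "a \<in> T" "b \<in> T" "v \<in> T" "T - {a} \<notin> cells V E"
    "cells V' E = insert (T - {a}) (cells V E - {T})"
proof -
  note i = ear_insert[OF E]
  have D: "dissection V E" using i(1) by (rule dissection_subset) auto
  obtain T where T: "T \<in> cells V E" "v \<in> T" "b \<in> T" "\<exists>z\<in>T. orient v b z < 0"
    "{z\<in>T. orient v b z \<ge> 0} \<notin> cells V E" "{z\<in>T. orient v b z \<le> 0} \<notin> cells V E"
    "cells V (insert c E) = insert {z\<in>T. orient v b z \<ge> 0} (insert {z\<in>T. orient v b z \<le> 0} (cells V E - {T}))"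
    by (rule cells_insert[OF V three i(1,2)])
  have TV: "T \<subseteq> V" by (rule cellsD(1)[OF V three D T(1)])
  have "a \<in> T" using T(4) TV ear_ge by (metis Diff_iff not_less singletonD subsetD)
  then have h: "{z\<in>T. orient v b z \<ge> 0} = T - {a}" "{z\<in>T. orient v b z \<le> 0} = {a, b, v}"
    using ear_halfplanes[OF TV] T(2,3) by auto
  have new: "{a, b, v} \<notin> cells V' E"
    using cellsD(1)[OF convex_position_V' card_V'(2) E, of "{a, b, v}"] by auto
  have "insert {a, b, v} (cells V' E) = insert (T - {a}) (insert {a, b, v} (cells V E - {T}))"
    using T(7) unfolding h i(3) .
  also have "\<dots> = insert {a, b, v} (insert (T - {a}) (cells V E - {T}))" by (rule insert_commute)
  finally have eq: "insert {a, b, v} (cells V' E) = \<dots>" .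
  have "{a, b, v} \<noteq> T - {a}" by auto
  moreover have "{a, b, v} \<notin> cells V E" using T(6) unfolding h .
  ultimately have "{a, b, v} \<notin> insert (T - {a}) (cells V E - {T})" by simp
  then have "cells V' E = insert (T - {a}) (cells V E - {T})"
    using eq insert_ident[OF new] by metis
  then show thesis using T(1,2,3,5) \<open>a \<in> T\<close> unfolding h by (intro that)
qed

end

section \<open>The two cases of the recurrence\<close>

lemma admissible_root_card:
  "admissible V a b k d D \<Longrightarrow> T \<in> cells V D \<Longrightarrow> a \<in> T \<Longrightarrow> b \<in> T \<Longrightarrow> d \<noteq> 1 \<Longrightarrow> card T = d + 1"
  unfolding admissible_def by simp

lemma admissible_other_card:
  assumes "admissible V a b k d D" "T \<in> cells V D" "\<not> (a \<in> T \<and> b \<in> T)" shows "card T = k + 1"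
proof -
  have "card T = (if a \<in> T \<and> b \<in> T then (if d = 1 then k else d) + 1 else k + 1)"
    using assms(1,2) unfolding admissible_def by (elim conjE bspec)
  then show ?thesis unfolding if_not_P[OF assms(3)] .
qed

context rooted_polygon_with_ear
begin

lemma triangle_card: "card {a, b, v} = 3"
  using ab va vb by auto

lemma admissible_ear_removed:
  assumes E: "dissection V' E" and d: "d \<ge> 3"
  shows "admissible V a b k d E \<longleftrightarrow> admissible V' v b k (d - 1) E"
proof -
  have D: "dissection V E" using ear_insert(1)[OF E] by (rule dissection_subset) auto
  obtain T where T: "T \<in> cells V E" "a \<in> T" "b \<in> T" "v \<in> T" "T - {a} \<notin> cells V E"
    "cells V' E = insert (T - {a}) (cells V E - {T})" by (rule ear_cells[OF E])
  have "finite T" by (rule cellsD(4)[OF V three D T(1)])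
  then have cT: "card T = card (T - {a}) + 1" using T(2) by (simp add: card_Suc_Diff1[symmetric] del: card_Diff_insert)
  have u: "\<not> (a \<in> S \<and> b \<in> S)" if "S \<in> cells V E" "S \<noteq> T" for S
    using unique_root_cellD[OF three D that(1) _ _ T(1-3)] that(2) by blast
  have T': "T - {a} \<in> cells V' E" "v \<in> T - {a}" "b \<in> T - {a}" using T va ab by simp_all
  have u': "\<not> (v \<in> S \<and> b \<in> S)" if "S \<in> cells V E" "S \<noteq> T" for S
  proof -
    have "S \<in> cells V' E" using that T(6) by simp
    moreover have "S \<noteq> T - {a}" using that(1) T(5) by metis
    ultimately show ?thesis
      using rooted_polygon.unique_root_cellD[OF rooted_V' card_V'(2) E _ _ _ T'] by blast
  qed
  have "admissible V a b k d E \<longleftrightarrow> card T = d + 1 \<and> (\<forall>S\<in>cells V E - {T}. card S = k + 1)"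
    unfolding admissible_def using D T(1-3) u d by auto
  moreover have "admissible V' v b k (d - 1) E \<longleftrightarrow>
      card (T - {a}) = d - 1 + 1 \<and> (\<forall>S\<in>cells V E - {T}. card S = k + 1)"
    unfolding admissible_def T(6) using E T'(2,3) u' d by auto
  ultimately show ?thesis using cT d by simp
qed

text \<open>For \<open>d \<ge> 3\<close> the base of the ear is not a chord, since the root cell extends beyond it. Hence both sides
are literally the same sets of chords.\<close>
lemma ear_case_ge3:
  assumes d: "d \<ge> 3"
  shows "{D. admissible V a b k d D \<and> (\<exists>T\<in>cells V D. a \<in> T \<and> b \<in> T \<and> v \<in> T)}
    = {D. admissible V' v b k (d - 1) D}"
proof (intro set_eqI iffI; unfold mem_Collect_eq)
  fix D assume "admissible V a b k d D \<and> (\<exists>T\<in>cells V D. a \<in> T \<and> b \<in> T \<and> v \<in> T)"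
  then obtain T where adm: "admissible V a b k d D" and T: "T \<in> cells V D" "a \<in> T" "b \<in> T" "v \<in> T" by blast
  have D: "dissection V D" using adm by (simp add: admissible_def)
  have cT: "card T = d + 1" using d by (intro admissible_root_card[OF adm T(1-3)]) simp
  have TV: "T \<subseteq> V" "finite T" by (rule cellsD[OF V three D T(1)])+
  have "c \<notin> D"
  proof
    assume "c \<in> D"
    from cell_one_side[OF V three D T(1) this]
    have "\<forall>z\<in>T. orient v b z \<le> 0" using T(2) ear_neg by fastforce
    then have "T = {z\<in>T. orient v b z \<le> 0}" by auto
    also have "\<dots> \<subseteq> {a, b, v}" using ear_halfplanes(2)[OF TV(1)] by simp
    finally have "card T \<le> card {a, b, v}" by (intro card_mono) simp_all
    then show False using cT d triangle_card by simp
  qed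
  then have "dissection V' D" using ear_remove[OF D T] by simp
  then show "admissible V' v b k (d - 1) D" using adm admissible_ear_removed d by simp
next
  fix D assume adm: "admissible V' v b k (d - 1) D"
  then have E: "dissection V' D" by (simp add: admissible_def)
  obtain T where "T \<in> cells V D" "a \<in> T" "b \<in> T" "v \<in> T" by (rule ear_cells[OF E])
  then show "admissible V a b k d D \<and> (\<exists>T\<in>cells V D. a \<in> T \<and> b \<in> T \<and> v \<in> T)"
    using adm admissible_ear_removed[OF E d] by blast
qed

text \<open>For \<open>d = 2\<close> the root cell is the ear itself, and its base is a chord.\<close>
lemma ear_case_2:
  "bij_betw (insert c) {E. admissible V' v b k 1 E}
    {D. admissible V a b k 2 D \<and> (\<exists>T\<in>cells V D. a \<in> T \<and> b \<in> T \<and> v \<in> T)}"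
  (is "bij_betw _ ?X ?Y")
proof (rule bij_betw_imageI)
  show "inj_on (insert c) ?X"
  proof (rule inj_onI)
    fix E E' assume "E \<in> ?X" "E' \<in> ?X" and eq: "insert c E = insert c E'"
    then have "dissection V' E" "dissection V' E'" by (simp_all add: admissible_def)
    then have "c \<notin> E" "c \<notin> E'" using ear_insert(2) by blast+
    then show "E = E'" using eq by (metis insert_ident)
  qed
  have adm: "admissible V a b k 2 (insert c E) \<longleftrightarrow> admissible V' v b k 1 E" if E: "dissection V' E" for E
  proof -
    have na: "a \<notin> S" if "S \<in> cells V' E" for S
      using cellsD(1)[OF convex_position_V' card_V'(2) E that] by auto
    show ?thesis
      unfolding admissible_def ear_insert(3)[OF E] using E ear_insert(1)[OF E] na triangle_card by auto
  qed
  show "insert c ` ?X = ?Y"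
  proof
    show "insert c ` ?X \<subseteq> ?Y"
    proof (rule image_subsetI)
      fix E assume "E \<in> ?X"
      then have E: "dissection V' E" "admissible V' v b k 1 E" by (simp_all add: admissible_def)
      have "{a, b, v} \<in> cells V (insert c E)" unfolding ear_insert(3)[OF E(1)] by simp
      then show "insert c E \<in> ?Y" using adm[OF E(1)] E(2) by blast
    qed
    show "?Y \<subseteq> insert c ` ?X"
    proof (rule subsetI)
      fix D assume "D \<in> ?Y"
      then obtain T where admD: "admissible V a b k 2 D" and T: "T \<in> cells V D" "a \<in> T" "b \<in> T" "v \<in> T" by blast
      have D: "dissection V D" using admD by (simp add: admissible_def)
      have cT: "card T = 3" using admissible_root_card[OF admD T(1-3)] by simp
      have "finite T" by (rule cellsD[OF V three D T(1)])
      then have T3: "{a, b, v} = T" using T cT triangle_card by (intro card_subset_eq) simp_all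
      have "orient b v a > 0" using ear_neg orient_swap[of b v a] by simp
      then have "\<forall>z\<in>T. orient b v z \<ge> 0" unfolding T3[symmetric] by simp
      from cell_edges[OF V three D T(1,3,4) vb[symmetric] this]
      have "closed_segment b v \<in> D \<or> (\<forall>z\<in>V. orient b v z \<ge> 0)" .
      moreover have "\<not> (\<forall>z\<in>V. orient b v z \<ge> 0)" using ex_pos orient_swap[of b v] by fastforce
      ultimately have "closed_segment b v \<in> D" by simp
      then have "c \<in> D" by (subst closed_segment_commute)
      have E: "dissection V' (D - {c})" by (rule ear_remove[OF D T])
      have ins: "insert c (D - {c}) = D" using \<open>c \<in> D\<close> by (rule insert_Diff)
      have "admissible V' v b k 1 (D - {c})" using adm[OF E] admD unfolding ins by simp
      then show "D \<in> insert c ` ?X" 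
        by (intro image_eqI[where x = "D - {c}"], simp only: ins) (simp only: mem_Collect_eq)
    qed
  qed
qed

lemma fan_insert:
  assumes E: "dissection V E" and T: "T \<in> cells V E" "a \<in> T" "w \<in> T"
    and yz: "y \<in> T" "orient a w y > 0" "z \<in> T" "orient a w z < 0"
  shows "dissection V (insert (closed_segment a w) E)" "closed_segment a w \<notin> E"
    "cells V (insert (closed_segment a w) E) =
       insert {z\<in>T. orient a w z \<ge> 0} (insert {z\<in>T. orient a w z \<le> 0} (cells V E - {T}))"
proof -
  let ?f = "closed_segment a w"
  have aw: "a \<noteq> w" using yz(2) by auto
  have TV: "T \<subseteq> V" by (rule cellsD[OF V three E T(1)])
  have "open_segment a w \<subseteq> open_hull T"
    by (rule diagonal_in_interior[OF cellsD(3)[OF V three E T(1)] T(2,3) yz(1,3,2,4)])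
  then have disj: "rel_interior ?f \<inter> e = {}" if "e \<in> E" for e
    unfolding rel_interior_segment[OF aw] using cellsD(5)[OF V three E T(1)] that by blast
  have ne: "rel_interior ?f \<noteq> {}" unfolding rel_interior_segment[OF aw] using aw by simp
  show nE: "?f \<notin> E"
    using disj[of ?f] ne rel_interior_subset[of ?f] by blast
  show D: "dissection V (insert ?f E)"
    unfolding dissection_def
  proof (intro conjI ballI impI)
    have "?f \<in> diagonals V"
      unfolding diagonals_def mem_Collect_eq
    proof (intro exI conjI)
      show "?f = closed_segment a w" ..
    qed (use TV T yz in blast)+
    then show "insert ?f E \<subseteq> diagonals V" using dissectionD(1)[OF E] by simp
    fix e e' assume e: "e \<in> insert ?f E" "e' \<in> insert ?f E" "e \<noteq> e'"
    consider "e = ?f" "e' \<in> E" | "e' = ?f" "e \<in> E" | "e \<in> E" "e' \<in> E" using e by blast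
    then show "rel_interior e \<inter> rel_interior e' = {}"
    proof cases
      case 1
      then show ?thesis using disj[OF 1(2)] rel_interior_subset[of e'] by blast
    next
      case 2
      then show ?thesis using disj[OF 2(2)] rel_interior_subset[of e] by blast
    next
      case 3
      then show ?thesis by (rule dissectionD(3)[OF E _ _ e(3)])
    qed
  qed
  obtain S where S: "S \<in> cells V E" "a \<in> S" "w \<in> S"
    "cells V (insert ?f E) = insert {z\<in>S. orient a w z \<ge> 0} (insert {z\<in>S. orient a w z \<le> 0} (cells V E - {S}))"
    by (rule cells_insert[OF V three D nE])
  have "T = S" by (rule cells_share_diagonal[OF V three E T(1) S(1) T(2,3) S(2,3) yz(1,3,2,4)])
  then show "cells V (insert ?f E) = insert {z\<in>T. orient a w z \<ge> 0} (insert {z\<in>T. orient a w z \<le> 0} (cells V E - {T}))"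
    using S(4) by simp
qed

text \<open>The diagonal \<open>a w\<close> cuts off a \<open>(k+1)\<close>-gon from the root cell.\<close>
definition cuts :: "nat \<Rightarrow> (real^2) set set \<Rightarrow> real^2 \<Rightarrow> bool" where
  "cuts k E w \<longleftrightarrow> w \<noteq> a \<and> (\<exists>T\<in>cells V E. a \<in> T \<and> b \<in> T \<and> w \<in> T \<and> card {z\<in>T. orient a w z \<ge> 0} = k + 1)"

lemma cuts_unique:
  assumes E: "dissection V E" and w: "cuts k E w" "cuts k E w'" and k: "k \<ge> 2"
  shows "w = w'"
proof -
  obtain T where T: "T \<in> cells V E" "a \<in> T" "b \<in> T" "w \<in> T" "card {z\<in>T. orient a w z \<ge> 0} = k + 1"
    using w(1) unfolding cuts_def by blast
  obtain T' where T': "T' \<in> cells V E" "a \<in> T'" "b \<in> T'" "w' \<in> T'" "card {z\<in>T'. orient a w' z \<ge> 0} = k + 1"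
    using w(2) unfolding cuts_def by blast
  have "T' = T" by (rule unique_root_cellD[OF three E T'(1-3) T(1-3)])
  have TV: "T \<subseteq> V" "finite T" by (rule cellsD[OF V three E T(1)])+
  have "card {z\<in>T. orient a w z \<ge> 0} \<le> card T" by (rule card_mono) (use TV in auto)
  then have "\<exists>!w. w \<in> T \<and> w \<noteq> a \<and> card {z\<in>T. orient a w z \<ge> 0} = k + 1"
    using T(5) k by (intro split_point[OF TV(1) T(2)]) simp_all
  then show ?thesis using T T' w unfolding \<open>T' = T\<close> cuts_def by (elim ex1E) metis
qed

text \<open>The remaining root cell has \<open>d + 1\<close> of the \<open>d + k\<close> vertices. It does not contain \<open>v\<close>, which is cut off because it comes last
around \<open>a\<close>; and \<open>w\<close> becomes the last vertex of the root cell.\<close>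
lemma fan_cut:
  assumes E: "admissible V a b k (d + k - 1) E" and k: "k \<ge> 2" and d: "d \<ge> 2"
  obtains w T where "cuts k E w" "closed_segment a w \<notin> E" "admissible V a b k d (insert (closed_segment a w) E)"
    "T \<in> cells V (insert (closed_segment a w) E)" "a \<in> T" "b \<in> T" "v \<notin> T" "w \<in> T" "w \<in> V" "w \<noteq> a"
    "\<And>z. z \<in> T \<Longrightarrow> orient a w z \<le> 0"
proof -
  have D: "dissection V E" using E by (simp add: admissible_def)
  obtain R where R: "R \<in> cells V E" "a \<in> R" "b \<in> R" using unique_root_cell[OF three D] by blast
  have RV: "R \<subseteq> V" "finite R" "convex_position R" by (rule cellsD[OF V three D R(1)])+
  have "d + k - 1 \<noteq> 1" using d k by simp
  then have cR: "card R = d + k" using admissible_root_card[OF E R] k by simp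
  have "\<exists>!w. w \<in> R \<and> w \<noteq> a \<and> card {z\<in>R. orient a w z \<ge> 0} = k + 1"
    by (rule split_point[OF RV(1) R(2)]) (use k d cR in simp_all)
  then obtain w where w: "w \<in> R" "w \<noteq> a" "card {z\<in>R. orient a w z \<ge> 0} = k + 1" by (elim ex1E conjE)
  let ?A = "{z\<in>R. orient a w z \<ge> 0}" and ?B = "{z\<in>R. orient a w z \<le> 0}"
  have wV: "w \<in> V" using w(1) RV(1) by auto
  have wb: "w \<noteq> b"
  proof
    assume "w = b"
    then have "?A = R" using root RV(1) by auto
    then show False using w(3) cR d by simp
  qed
  have bneg: "orient a w b < 0" using root_pos[OF wV w(2) wb] orient_flip[of w b] by simp
  obtain y where y: "y \<in> R" "orient a w y > 0"
  proof (rule ccontr)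
    assume "\<not> thesis"
    then have "\<And>z. z \<in> R \<Longrightarrow> orient a w z \<le> 0" using that by (meson not_le)
    then have "?A \<subseteq> {a, w}"
      using orient_zero_cases[OF V aV wV _ w(2)[symmetric]] RV(1) by fastforce
    then have "card ?A \<le> card {a, w}" by (intro card_mono) simp_all
    then show False using w(2,3) k by simp
  qed
  note fan = fan_insert[OF D R(1,2) w(1) y R(3) bneg]
  have "card ?A + card ?B = d + k + 2"
    using card_halfplanes[OF RV(3) R(2) w(1) w(2)[symmetric]] cR by simp
  then have cB: "card ?B = d + 1" using w(3) by simp
  have bA: "b \<notin> ?A" using bneg by simp
  have B: "a \<in> ?B" "b \<in> ?B" using R bneg by simp_all
  have u: "\<not> (a \<in> S \<and> b \<in> S)" if "S \<in> cells V E - {R}" for S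
    using unique_root_cellD[OF three D _ _ _ R] that by blast
  have "v \<noteq> w" using last[of y] y RV(1) orient_flip[of y w] by fastforce
  then have "orient a w v > 0" using last[OF wV w(2)] by simp
  then have vB: "v \<notin> ?B" by simp
  have small: "card S = k + 1" if S: "S \<in> cells V E - {R}" for S
  proof -
    have "\<not> (a \<in> S \<and> b \<in> S)" by (rule u[OF S])
    then show ?thesis using S by (intro admissible_other_card[OF E]) simp_all
  qed
  have "admissible V a b k d (insert (closed_segment a w) E)"
    unfolding admissible_def fan(3)
  proof (intro conjI ballI fan(1))
    fix S assume "S \<in> insert ?A (insert ?B (cells V E - {R}))"
    then consider "S = ?A" | "S = ?B" | "S \<in> cells V E - {R}" by blast
    then show "card S = (if a \<in> S \<and> b \<in> S then (if d = 1 then k else d) + 1 else k + 1)"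
    proof cases
      case 1
      then show ?thesis using w(3) bA by presburger
    next
      case 2
      then show ?thesis using cB B d by presburger
    next
      case 3
      then show ?thesis unfolding if_not_P[OF u[OF 3]] by (rule small)
    qed
  qed
  moreover have "?B \<in> cells V (insert (closed_segment a w) E)" unfolding fan(3) by simp
  moreover have "cuts k E w" unfolding cuts_def using R w by blast
  moreover have "w \<in> ?B" using w(1) by simp
  ultimately show thesis using fan(2) B vB wV w(2) by (intro that[of w ?B]) simp_all
qed

text \<open>Let \<open>w\<close> be the last vertex of the root cell around \<open>a\<close>. Then \<open>a w\<close> is a side of this cell and has \<open>v\<close> and
\<open>b\<close> on different sides, so by \<open>cell_edges\<close> it is a chord.\<close>
lemma fan_uncut:
  assumes D: "admissible V a b k d D" and k: "k \<ge> 2" and d: "d \<ge> 2"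
    and T: "T \<in> cells V D" "a \<in> T" "b \<in> T" "v \<notin> T"
  obtains w where "closed_segment a w \<in> D" "admissible V a b k (d + k - 1) (D - {closed_segment a w})"
    "cuts k (D - {closed_segment a w}) w"
proof -
  have dis: "dissection V D" using D by (simp add: admissible_def)
  have TV: "T \<subseteq> V" "3 \<le> card T" "finite T" by (rule cellsD[OF V three dis T(1)])+
  have cT: "card T = d + 1" using d by (intro admissible_root_card[OF D T(1-3)]) simp
  have two: "2 \<le> card T" using TV(2) by simp
  obtain w where w: "w \<in> T" "w \<noteq> a" "\<And>z. z \<in> T \<Longrightarrow> z \<noteq> a \<Longrightarrow> z \<noteq> w \<Longrightarrow> orient a z w > 0"
    using last_vertex[OF TV(1) T(2) two] by blast
  let ?f = "closed_segment a w"
  have wV: "w \<in> V" using w(1) TV(1) by auto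
  have wb: "w \<noteq> b"
  proof
    assume "w = b"
    have "\<not> T \<subseteq> {a, b}"
    proof
      assume "T \<subseteq> {a, b}"
      then have "card T \<le> card {a, b}" by (intro card_mono) simp_all
      then show False using TV(2) ab by simp
    qed
    then obtain z where z: "z \<in> T" "z \<noteq> a" "z \<noteq> b" by blast
    then have "orient a z b > 0" using w(3) \<open>w = b\<close> by simp
    then show False using root_pos[of z] z TV(1) orient_flip[of z b] by auto
  qed
  have bneg: "orient a w b < 0" using root_pos[OF wV w(2) wb] orient_flip[of w b] by simp
  have le: "orient a w z \<le> 0" if "z \<in> T" for z
  proof (cases "z = a \<or> z = w")
    case False
    then show ?thesis using w(3)[OF that] orient_flip[of z w] by simp
  qed auto
  have "v \<noteq> w" using T(4) w(1) by metis
  then have vpos: "orient a w v > 0" using last[OF wV w(2)] by simp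
  have "\<forall>z\<in>T. orient w a z \<ge> 0" using le by (simp add: orient_swap[of w a])
  from cell_edges[OF V three dis T(1) w(1) T(2) w(2) this]
  have "closed_segment w a \<in> D \<or> (\<forall>z\<in>V. orient w a z \<ge> 0)" .
  moreover have "\<not> (\<forall>z\<in>V. orient w a z \<ge> 0)" using vpos vV orient_swap[of w a v] by fastforce
  ultimately have "closed_segment w a \<in> D" by simp
  then have fD: "?f \<in> D" by (subst closed_segment_commute)
  let ?E = "D - {?f}"
  have ins: "insert ?f ?E = D" using fD by (rule insert_Diff)
  have E: "dissection V ?E" using dis by (rule dissection_subset) auto
  have D': "dissection V (insert ?f ?E)" unfolding ins by (rule dis)
  obtain R where R: "R \<in> cells V ?E" "a \<in> R" "w \<in> R" "\<exists>z\<in>R. orient a w z > 0" "\<exists>z\<in>R. orient a w z < 0"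
    "{z\<in>R. orient a w z \<ge> 0} \<notin> cells V ?E" "{z\<in>R. orient a w z \<le> 0} \<notin> cells V ?E"
    "cells V (insert ?f ?E) = insert {z\<in>R. orient a w z \<ge> 0} (insert {z\<in>R. orient a w z \<le> 0} (cells V ?E - {R}))"
    by (rule cells_insert[OF V three D']) simp
  let ?A = "{z\<in>R. orient a w z \<ge> 0}" and ?B = "{z\<in>R. orient a w z \<le> 0}"
  have cells: "cells V D = insert ?A (insert ?B (cells V ?E - {R}))" using R(8) unfolding ins .
  obtain y z where yz: "y \<in> R" "orient a w y > 0" "z \<in> R" "orient a w z < 0" using R(4,5) by blast
  have bA: "b \<notin> ?A" using bneg by simp
  have "T \<noteq> ?A" using T(3) bA by metis
  moreover have "T \<notin> cells V ?E - {R}"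
  proof
    assume "T \<in> cells V ?E - {R}"
    then have "T \<in> cells V ?E" "R \<noteq> T" by auto
    then show False using cells_share_diagonal[OF V three E R(1) _ R(2,3) T(2) w(1) yz(1,3,2,4)] by simp
  qed
  ultimately have TB: "T = ?B" using T(1) unfolding cells by blast
  then have bR: "b \<in> R" using T(3) by auto
  have "?A \<in> cells V D" unfolding cells by simp
  then have cA: "card ?A = k + 1" using bA by (intro admissible_other_card[OF D]) simp_all
  have RV: "convex_position R" by (rule cellsD[OF V three E R(1)])
  have "card ?A + card ?B = card R + 2" by (rule card_halfplanes[OF RV R(2,3) w(2)[symmetric]])
  then have cR: "card R = d + k" using cA cT unfolding TB[symmetric] by simp
  have "admissible V a b k (d + k - 1) ?E"
    unfolding admissible_def
  proof (intro conjI ballI E)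
    fix S assume S: "S \<in> cells V ?E"
    show "card S = (if a \<in> S \<and> b \<in> S then (if d + k - 1 = 1 then k else d + k - 1) + 1 else k + 1)"
    proof (cases "S = R")
      case True
      then show ?thesis using cR R(2) bR d k by simp
    next
      case False
      then have SD: "S \<in> cells V D" using S unfolding cells by simp
      have "S \<noteq> T" using S R(7) TB by metis
      then have n: "\<not> (a \<in> S \<and> b \<in> S)" using unique_root_cellD[OF three dis SD _ _ T(1-3)] by blast
      show ?thesis unfolding if_not_P[OF n] by (rule admissible_other_card[OF D SD n])
    qed
  qed
  moreover have "cuts k ?E w" unfolding cuts_def using R(1-3) bR cA w(2) by blast
  ultimately show thesis using fD by (intro that[of w])
qed

text \<open>The map that inserts the cutting chord is injective because the chord ends at the last vertex of the resulting root
cell.\<close>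
lemma fan_case:
  assumes k: "k \<ge> 2" and d: "d \<ge> 2"
  shows "card {D. admissible V a b k d D \<and> (\<exists>T\<in>cells V D. a \<in> T \<and> b \<in> T \<and> v \<notin> T)}
    = card {E. admissible V a b k (d + k - 1) E}"
    (is "card ?Y = card ?X")
proof -
  define f where "f E = insert (closed_segment a (SOME w. cuts k E w)) E" for E
  have dis: "dissection V E" if "E \<in> ?X" for E using that by (simp add: admissible_def)
  have f: "f E = insert (closed_segment a w) E" if "E \<in> ?X" "cuts k E w" for E w
  proof -
    have "cuts k E (SOME w. cuts k E w)" using that(2) by (rule someI)
    then have "(SOME w. cuts k E w) = w" by (rule cuts_unique[OF dis[OF that(1)] _ that(2) k])
    then show ?thesis unfolding f_def by simp
  qed
  have "bij_betw f ?X ?Y"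
  proof (rule bij_betw_imageI)
    show "inj_on f ?X"
    proof (rule inj_onI)
      fix E E' assume E: "E \<in> ?X" "E' \<in> ?X" and eq: "f E = f E'"
      obtain w T where w: "cuts k E w" "closed_segment a w \<notin> E"
        "admissible V a b k d (insert (closed_segment a w) E)"
        "T \<in> cells V (insert (closed_segment a w) E)" "a \<in> T" "b \<in> T" "w \<in> T" "w \<in> V" "w \<noteq> a"
        "\<And>z. z \<in> T \<Longrightarrow> orient a w z \<le> 0"
        using fan_cut[OF _ k d, of E] E(1) by (metis (no_types, lifting) mem_Collect_eq)
      obtain w' T' where w': "cuts k E' w'" "closed_segment a w' \<notin> E'"
        "T' \<in> cells V (insert (closed_segment a w') E')" "a \<in> T'" "b \<in> T'" "w' \<in> T'" "w' \<in> V" "w' \<noteq> a"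
        "\<And>z. z \<in> T' \<Longrightarrow> orient a w' z \<le> 0"
        using fan_cut[OF _ k d, of E'] E(2) by (metis (no_types, lifting) mem_Collect_eq)
      have eq': "insert (closed_segment a w) E = insert (closed_segment a w') E'"
        using eq f[OF E(1) w(1)] f[OF E(2) w'(1)] by simp
      have "dissection V (insert (closed_segment a w) E)" using w(3) by (simp add: admissible_def)
      then have "T = T'"
        by (rule unique_root_cellD[OF three _ w(4-6) _ w'(4,5)]) (unfold eq', rule w'(3))
      then have "orient a w w' \<le> 0" "orient a w' w \<le> 0" using w(10)[of w'] w'(9)[of w] w(7) w'(6) by simp_all
      then have "w = w'"
        using orient_total[OF w(8) w'(7) w(9) w'(8)] orient_flip[of w w'] by linarith
      then show "E = E'" using eq' w(2) w'(2) insert_ident by metis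
    qed
    show "f ` ?X = ?Y"
    proof
      show "f ` ?X \<subseteq> ?Y"
      proof (rule image_subsetI)
        fix E assume E: "E \<in> ?X"
        then have adm: "admissible V a b k (d + k - 1) E" by simp
        obtain w T where w: "cuts k E w" "admissible V a b k d (insert (closed_segment a w) E)"
          "T \<in> cells V (insert (closed_segment a w) E)" "a \<in> T" "b \<in> T" "v \<notin> T"
          by (rule fan_cut[OF adm k d]) (rule that)
        then show "f E \<in> ?Y" unfolding f[OF E w(1)] by blast
      qed
      show "?Y \<subseteq> f ` ?X"
      proof (rule subsetI)
        fix D assume "D \<in> ?Y"
        then obtain T where D: "admissible V a b k d D" and T: "T \<in> cells V D" "a \<in> T" "b \<in> T" "v \<notin> T" by blast
        obtain w where w: "closed_segment a w \<in> D" "admissible V a b k (d + k - 1) (D - {closed_segment a w})"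
          "cuts k (D - {closed_segment a w}) w" by (rule fan_uncut[OF D k d T])
        have X: "D - {closed_segment a w} \<in> ?X" using w(2) by simp
        have "f (D - {closed_segment a w}) = D" unfolding f[OF X w(3)] by (rule insert_Diff[OF w(1)])
        then show "D \<in> f ` ?X" using imageI[OF X, of f] by (simp only:)
      qed
    qed
  qed
  then show ?thesis by (rule bij_betw_same_card[symmetric])
qed

end

section \<open>Counting\<close>

lemma kd_catalan_0: "d \<ge> 1 \<Longrightarrow> kd_catalan 0 k d = 1"
  by (simp add: kd_catalan_def)

lemma kd_catalan_1:
  assumes k: "k \<ge> 2"
  shows "kd_catalan (Suc n) k 1 = kd_catalan n k k"
proof -
  define m where "m = k * n + k - 1"
  have m: "Suc m = k * Suc n" "m = k * n + k - 1" using k by (simp_all add: m_def)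
  have "real k * real (Suc n) * real (m choose n) = real (Suc m * (m choose n))"
    by (simp only: m(1) of_nat_mult)
  also have "\<dots> = real (Suc m choose Suc n) * real (Suc n)"
    by (simp only: Suc_times_binomial_eq of_nat_mult)
  finally have b: "real (Suc m choose Suc n) = real k * real (m choose n)" by simp
  have e: "k * Suc n + 1 - 1 = Suc m" using m by simp
  show ?thesis
    unfolding kd_catalan_def e m(2)[symmetric] b using k
    by (simp add: field_simps)
qed

text \<open>All three binomial coefficients have upper index \<open>m = k n + k + d - 1\<close> after one step of Pascal's rule,
and \<open>q = m - n\<close> is the common part of the denominators.\<close>
lemma kd_catalan_rec:
  assumes k: "k \<ge> 2" and d: "d \<ge> 1"
  shows "kd_catalan (Suc n) k (Suc d) = kd_catalan (Suc n) k d + kd_catalan n k (d + k)"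
proof -
  define m where "m = k * Suc n + d - 1"
  have m: "k * Suc n + Suc d - 1 = Suc m" "k * Suc n + d - 1 = m" "k * n + (d + k) - 1 = m"
    using d by (simp_all add: m_def)
  define q where "q = (real k - 1) * real (Suc n) + real d"
  have q: "q > 0" using k d unfolding q_def by (intro add_nonneg_pos) simp_all
  have mn: "real (m - n) = q"
  proof -
    have "n \<le> k * n" using k by simp
    moreover have "m = k * n + k + d - 1" by (simp add: m_def)
    ultimately have "n \<le> m" using d by linarith
    moreover have "real m = real k * real (Suc n) + real d - 1" using d k by (simp add: m_def of_nat_diff algebra_simps)
    ultimately show ?thesis unfolding q_def by (simp add: of_nat_diff algebra_simps)
  qed
  have "Suc n * (m choose Suc n) = (m - n) * (m choose n)"
    using binomial_absorption[of n m] binomial_absorb_comp[of m n] by simp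
  then have "real (Suc n * (m choose Suc n)) = real ((m - n) * (m choose n))" by (simp only:)
  then have X: "real (Suc n) * real (m choose Suc n) = q * real (m choose n)"
    by (simp only: of_nat_mult mn)
  then have X': "real (m choose Suc n) = q * real (m choose n) / real (Suc n)"
    by (simp add: field_simps)
  have den: "(real k - 1) * real (Suc n) + real (Suc d) = q + 1" "(real k - 1) * real (Suc n) + real d = q"
    "(real k - 1) * real n + real (d + k) = q + 1"
    unfolding q_def by (simp_all add: algebra_simps)
  define B where "B = real (m choose n)"
  define N where "N = real (Suc n)"
  have N: "N > 0" unfolding N_def by simp
  have "real (Suc d) / (q + 1) * (q * B / N + B) = real d / q * (q * B / N) + real (d + k) / (q + 1) * B"
  proof -
    \<comment> \<open>Only here does the value of \<open>q\<close> matter.\<close>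
    have lin: "(real d + 1) * (q + N) = real d * (q + 1) + (real d + real k) * N"
      unfolding q_def N_def by (simp add: algebra_simps)
    have "real (Suc d) / (q + 1) * (q * B / N + B) = B * ((real d + 1) * (q + N)) / ((q + 1) * N)"
      using N q by (simp add: field_simps)
    also have "\<dots> = real d / q * (q * B / N) + real (d + k) / (q + 1) * B"
      unfolding lin using N q by (simp add: field_simps)
    finally show ?thesis .
  qed
  then show ?thesis
    unfolding kd_catalan_def m den binomial_Suc_Suc of_nat_add[of "m choose n"] X' B_def N_def
    by (simp add: add.commute)
qed

lemma finite_admissible:
  assumes "convex_position V" shows "finite {D. admissible V a b k d D}"
proof (rule finite_subset)
  show "{D. admissible V a b k d D} \<subseteq> Pow (diagonals V)"
    using dissectionD(1) unfolding admissible_def by blast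
  show "finite (Pow (diagonals V))" using finite_diagonals[OF assms] by simp
qed

lemma (in rooted_polygon) admissible_whole:
  assumes c: "card V \<ge> 3" "card V = d + 1"
  shows "{D. admissible V a b k d D} = {{}}"
proof -
  have d1: "d \<noteq> 1" using c by simp
  have "dissection V {}" by (simp add: dissection_def)
  then have "admissible V a b k d {}"
    unfolding admissible_def cells_empty[OF V c(1)] using aV bV c d1 by simp
  moreover have "D = {}" if adm: "admissible V a b k d D" for D
  proof (rule ccontr)
    assume "D \<noteq> {}"
    then obtain e where e: "e \<in> D" by blast
    have D: "dissection V D" using adm by (simp add: admissible_def)
    obtain p q where pq: "e = closed_segment p q" "\<exists>z\<in>V. orient p q z > 0" "\<exists>z\<in>V. orient p q z < 0"
      by (rule diagonalE[OF dissectionD(2)[OF D e]])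
    obtain T where T: "T \<in> cells V D" "a \<in> T" "b \<in> T" using unique_root_cell[OF c(1) D] by blast
    have "card T = card V" using admissible_root_card[OF adm T d1] c(2) by simp
    then have "T = V"
      using V by (intro card_subset_eq cellsD(1)[OF V c(1) D T(1)]) (simp_all add: convex_position_def)
    then have "V \<in> cells V D" using T(1) by simp
    moreover have "closed_segment p q \<in> D" using e pq(1) by simp
    ultimately show False using cell_one_side[OF V c(1) D] pq(2,3) by fastforce
  qed
  ultimately show ?thesis by blast
qed

text \<open>The last vertex \<open>v\<close> around \<open>a\<close> either belongs to the root cell or does not.\<close>
lemma card_admissible_step:
  assumes rooted: "rooted_polygon V a b" and k: "k \<ge> 2" and d: "d \<ge> 2" and c: "card V \<ge> 4"
  obtains v where "v \<in> V" "v \<noteq> a" "rooted_polygon (V - {a}) v b"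
    "card {D. admissible V a b k d D}
      = card {E. admissible (V - {a}) v b k (d - 1) E} + card {E. admissible V a b k (d + k - 1) E}"
proof -
  interpret rooted_polygon V a b by (rule rooted)
  have two: "2 \<le> card V" using c by simp
  obtain v where v: "v \<in> V" "v \<noteq> a" "\<And>z. z \<in> V \<Longrightarrow> z \<noteq> a \<Longrightarrow> z \<noteq> v \<Longrightarrow> orient a z v > 0"
    using last_vertex[OF subset_refl aV two] by blast
  interpret ear: rooted_polygon_with_ear V a b v
    by unfold_locales (use v c in simp_all)
  let ?I = "{D. admissible V a b k d D \<and> (\<exists>T\<in>cells V D. a \<in> T \<and> b \<in> T \<and> v \<in> T)}"
  let ?J = "{D. admissible V a b k d D \<and> (\<exists>T\<in>cells V D. a \<in> T \<and> b \<in> T \<and> v \<notin> T)}"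
  have ex: "\<exists>T\<in>cells V D. a \<in> T \<and> b \<in> T" if "admissible V a b k d D" for D
  proof -
    have "dissection V D" using that by (simp add: admissible_def)
    then show ?thesis using unique_root_cell[OF ear.three] by blast
  qed
  then have eq: "{D. admissible V a b k d D} = ?I \<union> ?J" by auto
  have disj: "?I \<inter> ?J = {}"
  proof -
    have False if D: "admissible V a b k d D" and T: "T \<in> cells V D" "a \<in> T" "b \<in> T" "v \<in> T"
      and S: "S \<in> cells V D" "a \<in> S" "b \<in> S" "v \<notin> S" for D S T
    proof -
      have "dissection V D" using D by (simp add: admissible_def)
      then have "S = T" using unique_root_cellD[OF ear.three _ S(1-3) T(1-3)] by simp
      then show False using T(4) S(4) by simp
    qed
    then show ?thesis by (intro equals0I) (elim IntE CollectE conjE bexE)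
  qed
  have fin: "finite ?I" "finite ?J"
    using finite_admissible[OF V, of a b k d] by simp_all
  have "card {D. admissible V a b k d D} = card ?I + card ?J"
    unfolding eq by (rule card_Un_disjoint[OF fin disj])
  moreover have "card ?I = card {E. admissible (V - {a}) v b k (d - 1) E}"
  proof (cases "d = 2")
    case True
    then show ?thesis using bij_betw_same_card[OF ear.ear_case_2] by simp
  next
    case False
    then show ?thesis using ear.ear_case_ge3[of d] d by simp
  qed
  moreover have "card ?J = card {E. admissible V a b k (d + k - 1) E}" by (rule ear.fan_case[OF k d])
  ultimately show thesis using v(1,2) ear.rooted_V' by (intro that) simp_all
qed

text \<open>Lexicographic induction: the recurrence decreases either \<open>n\<close>, or \<open>d\<close> with the same \<open>n\<close>; for \<open>d = 1\<close> it decreases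
\<open>n\<close> and resets \<open>d\<close> to \<open>k\<close>.\<close>
theorem card_admissible:
  assumes k: "k \<ge> 2"
  shows "rooted_polygon V a b \<Longrightarrow> card V = n * (k - 1) + d + 1 \<Longrightarrow> card V \<ge> 3 \<Longrightarrow> d \<ge> 1 \<Longrightarrow>
    real (card {D. admissible V a b k d D}) = kd_catalan n k d"
proof (induction n arbitrary: V a b d)
  case 0
  then show ?case using rooted_polygon.admissible_whole[of V a b d k] kd_catalan_0[of d k] by simp
next
  case (Suc n)
  note IH = Suc.IH
  obtain j where j: "k = Suc (Suc j)" using k by (metis add_2_eq_Suc le_Suc_ex)
  show ?case using Suc.prems
  proof (induction d arbitrary: V a b)
    case 0
    then show ?case by simp
  next
    case (Suc d)
    show ?case
    proof (cases "d = 0")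
      case True
      \<comment> \<open>The cell at the root edge is a \<open>(k+1)\<close>-gon like the others, so \<open>d = 1\<close> may be read as \<open>d = k\<close>.\<close>
      have "admissible V a b k (Suc d) D \<longleftrightarrow> admissible V a b k k D" for D
        unfolding admissible_def True using k by simp
      moreover have "card V = n * (k - 1) + k + 1" using Suc.prems(2) True j by simp
      then have "real (card {D. admissible V a b k k D}) = kd_catalan n k k"
        using k by (intro Suc.prems IH) simp_all
      ultimately show ?thesis using kd_catalan_1[OF k, of n] True by simp
    next
      case False
      have c4: "card V \<ge> 4" using Suc.prems(2) False j by simp
      obtain v where v: "v \<in> V" "v \<noteq> a" "rooted_polygon (V - {a}) v b"
        "card {D. admissible V a b k (Suc d) D}
          = card {E. admissible (V - {a}) v b k (Suc d - 1) E} + card {E. admissible V a b k (Suc d + k - 1) E}"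
        by (rule card_admissible_step[OF Suc.prems(1) k _ c4, of "Suc d"]) (use False in simp)
      have aV: "a \<in> V" "finite V"
        using Suc.prems(1) by (simp_all add: rooted_polygon_def convex_position_def)
      have "real (card {E. admissible (V - {a}) v b k d E}) = kd_catalan (Suc n) k d"
        using Suc.prems(2) aV c4 False by (intro Suc.IH[OF v(3)]) simp_all
      moreover have "card V = n * (k - 1) + (d + k) + 1" using Suc.prems(2) j by simp
      then have "real (card {E. admissible V a b k (d + k) E}) = kd_catalan n k (d + k)"
        using k by (intro Suc.prems IH) simp_all
      ultimately show ?thesis
        using v(4) kd_catalan_rec[OF k, of d n] False by simp
    qed
  qed
qed

lemma inj_on_open_hull:
  assumes V: "convex_position V" "card V \<ge> 3" "dissection V D"
  shows "inj_on open_hull (cells V D)"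
proof (rule inj_onI)
  fix S T assume ST: "S \<in> cells V D" "T \<in> cells V D" "open_hull S = open_hull T"
  have "vertices (closure (open_hull S)) = vertices (closure (open_hull T))" by (simp only: ST(3))
  then show "S = T"
    unfolding cellsD(6)[OF V ST(1)] cellsD(6)[OF V ST(2)]
      vertices_convex_hull[OF cellsD(3)[OF V ST(1)]] vertices_convex_hull[OF cellsD(3)[OF V ST(2)]] .
qed

text \<open>By \<open>sum_cells\<close>: every cell other than the root cell contributes \<open>k - 1\<close>, and the root cell \<open>d - 1\<close>.\<close>
lemma (in rooted_polygon) admissible_cell_count:
  assumes c: "card V = n * (k - 1) + d + 1" "card V \<ge> 3" and k: "k \<ge> 2" and d: "d \<ge> 1"
    and adm: "admissible V a b k d D"
  shows "d = 1 \<Longrightarrow> card (cells V D) = n"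
    "d \<noteq> 1 \<Longrightarrow> card {T \<in> cells V D. \<not> (a \<in> T \<and> b \<in> T)} = n"
proof -
  have D: "dissection V D" using adm by (simp add: admissible_def)
  have fin: "finite (cells V D)" by (rule finite_cells[OF V c(2) D])
  note sum = sum_cells[OF V c(2) D]
  {
    assume d1: "d = 1"
    have "(\<Sum>T\<in>cells V D. card T - 2) = (\<Sum>T\<in>cells V D. k - 1)"
      using adm d1 unfolding admissible_def by (intro sum.cong) auto
    then have "card (cells V D) * (k - 1) = n * (k - 1)" using sum c(1) d1 by auto
    then show "card (cells V D) = n" using k by simp
  next
    assume d1: "d \<noteq> 1"
    obtain T where T: "T \<in> cells V D" "a \<in> T" "b \<in> T" using unique_root_cell[OF c(2) D] by blast
    have eq: "{T \<in> cells V D. \<not> (a \<in> T \<and> b \<in> T)} = cells V D - {T}"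
      using unique_root_cellD[OF c(2) D _ _ _ T] T by blast
    have "card T = d + 1" by (rule admissible_root_card[OF adm T d1])
    moreover have "(\<Sum>T\<in>cells V D - {T}. card T - 2) = (\<Sum>T\<in>cells V D - {T}. k - 1)"
    proof (rule sum.cong[OF refl])
      fix S assume "S \<in> cells V D - {T}"
      then have "S \<in> cells V D" "\<not> (a \<in> S \<and> b \<in> S)" unfolding eq[symmetric] by simp_all
      then have "card S = k + 1" by (rule admissible_other_card[OF adm])
      then show "card S - 2 = k - 1" by simp
    qed
    ultimately have "(d - 1) + card (cells V D - {T}) * (k - 1) = card V - 2"
      using sum sum.remove[OF fin T(1), of "\<lambda>T. card T - 2"] by simp
    then have "card (cells V D - {T}) * (k - 1) = n * (k - 1)" using c(1) d by linarith
    then show "card {T \<in> cells V D. \<not> (a \<in> T \<and> b \<in> T)} = n" unfolding eq using k by simp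
  }
qed

theorem theorem2p4:
  fixes n d k :: nat and P r :: "(real^2) set"
  assumes "d \<ge> 1" and "k \<ge> 2"
    and "convex_polygon (n * (k - 1) + d + 1) P"
    and "r edge_of P"
  shows "kd_catalan n k d = real (card {D. kd_partition (k + 1) (d + 1) P r D}) \<and>
    (\<forall>D. kd_partition (k + 1) (d + 1) P r D \<longrightarrow>
       finite (bounded_regions P D) \<and>
       (if d = 1 then card (bounded_regions P D) = n
        else card {R \<in> bounded_regions P D. \<not> r \<subseteq> closure R} = n \<and>
             (\<exists>!R. R \<in> bounded_regions P D \<and> r \<subseteq> closure R)))"
proof -
  define V where "V = vertices P"
  have V: "convex_position V" and P: "P = convex hull V" and cV: "card V = n * (k - 1) + d + 1"
    using assms(3) convex_position_vertices[of P] unfolding convex_polygon_def V_def by auto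
  obtain p q where pq: "p \<in> V" "q \<in> V" "p \<noteq> q" "r = closed_segment p q"
    using edge_of_hullE[OF V] assms(4) unfolding P by metis
  show ?thesis
  proof (cases "card V \<ge> 3")
    case c3: True
    obtain a b where rab: "rooted_polygon V a b" "r = closed_segment a b"
    proof -
      consider "\<forall>z\<in>V. orient p q z \<ge> 0" | "\<forall>z\<in>V. orient p q z \<le> 0"
        using assms(4) unfolding P pq(4) edge_of_hull_iff[OF V pq(1-3)] by blast
      then show thesis
      proof cases
        case 1
        then show thesis using V pq by (intro that[of p q]) (simp_all add: rooted_polygon_def)
      next
        case 2
        then have "rooted_polygon V q p"
          using V pq by (simp add: rooted_polygon_def orient_swap[of q p])
        moreover have "r = closed_segment q p" unfolding pq(4) by (rule closed_segment_commute)
        ultimately show thesis by (rule that)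
      qed
    qed
    interpret rooted_polygon V a b by (rule rab(1))
    have iff: "kd_partition (k + 1) (d + 1) P r D \<longleftrightarrow> admissible V a b k d D" for D
      unfolding P rab(2) by (rule kd_partition_iff_admissible[OF V c3 aV bV assms(1)])
    have regions: "finite (bounded_regions P D) \<and>
       (if d = 1 then card (bounded_regions P D) = n
        else card {R \<in> bounded_regions P D. \<not> r \<subseteq> closure R} = n \<and>
             (\<exists>!R. R \<in> bounded_regions P D \<and> r \<subseteq> closure R))" if adm: "admissible V a b k d D" for D
    proof -
      have D: "dissection V D" using adm by (simp add: admissible_def)
      have B: "bounded_regions P D = open_hull ` cells V D" unfolding P by (rule bounded_regions_eq[OF V c3 D])
      note inj = inj_on_open_hull[OF V c3 D]
      have sub: "r \<subseteq> closure (open_hull T) \<longleftrightarrow> a \<in> T \<and> b \<in> T" if "T \<in> cells V D" for T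
        unfolding cellsD(6)[OF V c3 D that] rab(2)
        by (rule segment_subset_hull[OF V cellsD(1)[OF V c3 D that] aV bV])
      have fin: "finite (bounded_regions P D)" unfolding B using finite_cells[OF V c3 D] by simp
      note count = admissible_cell_count[OF cV c3 assms(2,1) adm]
      have "card (bounded_regions P D) = n" if "d = 1"
        unfolding B card_image[OF inj] by (rule count(1)[OF that])
      moreover have "card {R \<in> bounded_regions P D. \<not> r \<subseteq> closure R} = n" if "d \<noteq> 1"
      proof -
        have "{R \<in> bounded_regions P D. \<not> r \<subseteq> closure R} = open_hull ` {T \<in> cells V D. \<not> (a \<in> T \<and> b \<in> T)}"
          unfolding B using sub by blast
        moreover have "inj_on open_hull {T \<in> cells V D. \<not> (a \<in> T \<and> b \<in> T)}"
          by (rule inj_on_subset[OF inj]) blast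
        ultimately show ?thesis using count(2)[OF that] by (simp add: card_image)
      qed
      moreover have "\<exists>!R. R \<in> bounded_regions P D \<and> r \<subseteq> closure R"
      proof -
        obtain T where T: "T \<in> cells V D" "a \<in> T" "b \<in> T" using unique_root_cell[OF c3 D] by blast
        show ?thesis
        proof (rule ex1I[of _ "open_hull T"])
          show "open_hull T \<in> bounded_regions P D \<and> r \<subseteq> closure (open_hull T)"
            using T sub[OF T(1)] unfolding B by simp
          fix R assume "R \<in> bounded_regions P D \<and> r \<subseteq> closure R"
          then obtain S where S: "S \<in> cells V D" "R = open_hull S" "r \<subseteq> closure (open_hull S)" unfolding B by blast
          then have "S = T" using sub[OF S(1)] unique_root_cellD[OF c3 D S(1) _ _ T] by simp
          then show "R = open_hull T" using S(2) by simp
        qed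
      qed
      ultimately show ?thesis using fin by simp
    qed
    show ?thesis
      unfolding iff using card_admissible[OF assms(2) rab(1) cV c3 assms(1)] regions by simp
  next
    case False
    \<comment> \<open>The polygon is a segment. It has no chords, and its complement is connected and unbounded.\<close>
    then have nd: "n = 0" "d = 1" using cV assms(1,2) by (cases n; simp)+
    then have c2: "card V = 2" using cV by simp
    have fV: "finite V" using V by (simp add: convex_position_def)
    have "{p, q} = V" by (rule card_subset_eq[OF fV]) (use pq c2 in simp_all)
    then have Pr: "P = r" unfolding P pq(4) segment_convex_hull by simp
    have "diagonals V = {}"
    proof -
      have False if c: "c \<in> diagonals V" for c
      proof -
        obtain x y where xy: "x \<in> V" "y \<in> V" "x \<noteq> y" "\<exists>z\<in>V. orient x y z > 0" by (rule diagonalE[OF c])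
        have "{x, y} = V" by (rule card_subset_eq[OF fV]) (use xy c2 in simp_all)
        then show False using xy(4) by force
      qed
      then show ?thesis by blast
    qed
    then have part: "polygon_partition P D \<longleftrightarrow> D = {}" for D
      unfolding P polygon_partition_iff[OF V] dissection_def by auto
    have edges: "\<Union>({e. e edge_of P} \<union> {}) = P" using assms(4) edge_of_imp_subset unfolding Pr by blast
    have bP: "bounded P" "convex P" unfolding Pr pq(4) by (simp_all add: compact_imp_bounded)
    have unb: "\<not> bounded (- P)" using bP(1) cobounded_imp_unbounded[of "- P"] by simp
    then have "- P \<noteq> {}" using bounded_empty by metis
    moreover have "connected (- P)" using bP by (rule connected_complement_bounded_convex) simp
    ultimately have "components (- P) = {- P}" by (simp only: components_eq_sing_iff simp_thms)
    then have br: "bounded_regions P {} = {}"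
      unfolding bounded_regions_def edges using unb by auto
    then have "kd_partition (k + 1) (d + 1) P r D \<longleftrightarrow> D = {}" for D
      unfolding kd_partition_def part nd by auto
    then show ?thesis using br nd kd_catalan_0[of 1 k] by simp
  qed
qed

end
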